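(* For every positive integer $t$ there exist a positive integer $n_0$ and constants $C,\alpha>0$ (depending only on $t$) such that for every integer $n>n_0$ there exists a polytope $P\subseteq[0,1]^n$ with at most $Cn$ facets such that the split rank of $P$ is at least $\alpha n$.
   Context: Split closure and rank: for $P\subseteq\mathbb{R}^n$, the split closure of $P$ is $$SC(P)=\bigcap_{\pi\in\mathbb{Z}^n,\ \pi_0\in\mathbb{Z}}\mathrm{conv}\big(\{x\in P:\pi x\le\pi_0\}\cup\{x\in P:\pi x\ge\pi_0+1\}\big),$$ where $\pi x$ denotes the inner product. Put $SC^0(P)=P$ and $SC^k(P)=SC(SC^{k-1}(P))$ for $k\ge1$. Let $P_I$ denote the convex hull of the integral points of $P$. The split rank of $P$ is the minimum $k\ge0$ such that $SC^k(P)=P_I$. *)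

theory Defs
  imports "HOL-Analysis.Analysis" "HOL-Library.Function_Algebras"
begin

text \<open>
  The dimension \<open>n\<close> is quantified inside the statement, after constants that must not depend on it,
  so it cannot be a type. The space \<open>\<real>\<^sup>n\<close> is the subspace of those \<open>x :: nat \<Rightarrow> real\<close> with
  \<open>x i = 0\<close> for all \<open>i \<ge> n\<close>. With the pointwise vector space structure on functions, the library's
  \<^const>\<open>convex\<close>, \<^const>\<open>hull\<close>, \<^const>\<open>polytope\<close> and \<^const>\<open>face_of\<close> apply to it directly.
\<close>

instantiation "fun" :: (type, real_vector) real_vector
begin

definition scaleR_fun_def: "c *\<^sub>R f = (\<lambda>x. c *\<^sub>R f x)"

instance
  by standard (simp_all add: scaleR_fun_def fun_eq_iff scaleR_add_right scaleR_add_left)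

end

lemma scaleR_fun_apply [simp]: "(c *\<^sub>R f) x = c *\<^sub>R f x"
  by (simp add: scaleR_fun_def)

definition real_vectors :: "nat \<Rightarrow> (nat \<Rightarrow> real) set" where
  "real_vectors n = {x. \<forall>i\<ge>n. x i = 0}"

definition integer_vectors :: "nat \<Rightarrow> (nat \<Rightarrow> real) set" where
  "integer_vectors n = {x \<in> real_vectors n. \<forall>i<n. x i \<in> \<int>}"

definition unit_cube :: "nat \<Rightarrow> (nat \<Rightarrow> real) set" where
  "unit_cube n = {x \<in> real_vectors n. \<forall>i<n. 0 \<le> x i \<and> x i \<le> 1}"

definition inner_prod :: "nat \<Rightarrow> (nat \<Rightarrow> real) \<Rightarrow> (nat \<Rightarrow> real) \<Rightarrow> real" where
  "inner_prod n x y = (\<Sum>i<n. x i * y i)"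

text \<open>
  The library's \<^const>\<open>aff_dim\<close> and \<^const>\<open>facet_of\<close> are restricted to the class
  \<open>euclidean_space\<close>; the following versions need only \<open>real_vector\<close>. They are meaningful for
  sets of finite affine dimension, because \<^const>\<open>dim\<close> is \<open>0\<close> on sets of infinite dimension.
\<close>

definition affine_dimension :: "'a::real_vector set \<Rightarrow> int" where
  "affine_dimension S = (if S = {} then -1 else int (dim {x - y |x y. x \<in> S \<and> y \<in> S}))"

lemma affine_dimension_eq_aff_dim:
  fixes S :: "'a::euclidean_space set"
  shows "affine_dimension S = aff_dim S"
proof (cases "S = {}")
  case True
  then show ?thesis by (simp add: affine_dimension_def)
next
  case False
  then obtain a where a: "a \<in> S" by blast
  let ?D = "{x - y |x y. x \<in> S \<and> y \<in> S}"
  let ?T = "(\<lambda>x. x - a) ` S"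
  have "?T \<subseteq> ?D" using a by blast
  moreover have "?D \<subseteq> span ?T"
  proof clarify
    fix x y assume "x \<in> S" "y \<in> S"
    then have "(x - a) - (y - a) \<in> span ?T"
      by (intro span_diff span_base) auto
    then show "x - y \<in> span ?T" by simp
  qed
  ultimately have "span ?D = span ?T"
    by (simp add: span_eq span_superset order_trans[OF _ span_superset])
  then have "dim ?D = dim ?T"
    by (rule span_eq_dim)
  then show ?thesis
    using False aff_dim_eq_dim_subtract[OF hull_inc[OF a]] by (simp add: affine_dimension_def)
qed

definition facets :: "'a::real_vector set \<Rightarrow> 'a set set" where
  "facets S = {F. F face_of S \<and> F \<noteq> {} \<and> affine_dimension F = affine_dimension S - 1}"

definition split_closure :: "nat \<Rightarrow> (nat \<Rightarrow> real) set \<Rightarrow> (nat \<Rightarrow> real) set" where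
  "split_closure n P =
    (\<Inter>p\<in>integer_vectors n. \<Inter>p0::int.
      convex hull ({x \<in> P. inner_prod n p x \<le> of_int p0} \<union>
                   {x \<in> P. inner_prod n p x \<ge> of_int p0 + 1}))"

definition integer_hull :: "nat \<Rightarrow> (nat \<Rightarrow> real) set \<Rightarrow> (nat \<Rightarrow> real) set" where
  "integer_hull n P = convex hull (P \<inter> integer_vectors n)"

text \<open>The infimum is the minimum when some \<open>k\<close> works, and \<open>\<infinity>\<close> otherwise.\<close>

definition split_rank :: "nat \<Rightarrow> (nat \<Rightarrow> real) set \<Rightarrow> enat" where
  "split_rank n P = Inf {enat k |k. (split_closure n ^^ k) P = integer_hull n P}"

end

theory Submission
  imports Defs
begin

text \<open>
  The polytope is a slice of the cube by one hyperplane, \<open>{x \<in> [0,1]\<^sup>n. w \<cdot> x = b}\<close> with positive integer weights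
  \<open>w\<close> and an integer \<open>b\<close>. It has at most \<open>2 n\<close> facets, one for each inequality of the cube
  (\<open>card_facets_knapsack\<close>). The weights are chosen such that the slice contains no integer point, and yet linearly
  many rounds of split cuts do not empty it.

  The surviving points have prescribed 0/1 values on a small set of coordinates and one common value, close to
  \<open>1/2\<close>, on all others (\<open>binary_points\<close>). Consider such a point \<open>x\<close> and a split with normal \<open>p\<close>. If on the free
  coordinates \<open>p\<close> is not almost proportional to \<open>w\<close>, one can vary boundedly many free coordinates, letting the
  others compensate to stay on the hyperplane, so that \<open>p \<cdot> x\<close> moves by at least 1 up and down; \<open>x\<close> is then a
  midpoint of points on both sides of the split. If \<open>p\<close> is almost proportional to \<open>w\<close>, one wants it to be an exact
  integer multiple of \<open>w\<close> off a bounded set: after rounding the coordinates of that set to 0 and 1 in all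
  possible ways, \<open>p \<cdot> x\<close> is an integer and the split does not separate anything. Either way a round uses up at
  most 264 coordinates (\<open>binary_point_survives_split\<close>), and linearly many rounds are possible before the common
  value can be driven away from \<open>1/2\<close>.

  It remains to find weights such that every integer vector almost proportional to \<open>w\<close> is an integer multiple
  of \<open>w\<close> (\<open>hard_knapsack_exists\<close>). Take \<open>N = 11\<^sup>s\<close> with \<open>s\<close> proportional to \<open>n\<close>, let \<open>3 s\<close> of the weights be generic
  residues modulo \<open>N\<close> and all others equal to \<open>N\<close>. The weights \<open>N\<close> force the factor of proportionality to be
  nearly a fraction \<open>k / N\<close>, and counting shows that for generic residues \<open>a\<close> the numbers \<open>k a / N\<close> are close to
  integers for most \<open>a\<close> only if \<open>N\<close> divides \<open>k\<close> (\<open>generic_residues_exist\<close>). There are more residues modulo \<open>N\<close>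
  than subset sums of the generic weights, so \<open>b\<close> can be taken in a class which no 0/1 vector attains
  (\<open>missed_residue_exists\<close>).
\<close>

section \<open>Faces of equal dimension\<close>

text \<open>
  A negative coefficient of \<open>x - y\<close> is a positive coefficient of \<open>y - x\<close>, and by convexity a sum of positive
  multiples of differences is a multiple of one difference of two averages.
\<close>

lemma span_differences_convex:
  fixes F :: "'a::real_vector set"
  assumes "convex F" "F \<noteq> {}" "d \<in> span {x - y |x y. x \<in> F \<and> y \<in> F}"
  shows "\<exists>A y z. A \<ge> 0 \<and> y \<in> F \<and> z \<in> F \<and> d = A *\<^sub>R (y - z)"
proof -
  let ?R = "{d. \<exists>A y z. A \<ge> 0 \<and> y \<in> F \<and> z \<in> F \<and> d = A *\<^sub>R (y - z)}"
  have "subspace ?R"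
    unfolding subspace_def
  proof (intro conjI ballI allI)
    show "0 \<in> ?R" using assms(2) by force
  next
    fix d e assume "d \<in> ?R" "e \<in> ?R"
    then obtain A y z A' y' z' where d: "A \<ge> 0" "y \<in> F" "z \<in> F" "d = A *\<^sub>R (y - z)"
      and e: "A' \<ge> 0" "y' \<in> F" "z' \<in> F" "e = A' *\<^sub>R (y' - z')" by blast
    show "d + e \<in> ?R"
    proof (cases "A + A' = 0")
      case True
      then have "A = 0" "A' = 0" using d e by auto
      then have "d + e = 0 *\<^sub>R (y - z)" using d e by simp
      then show ?thesis using d by blast
    next
      case False
      let ?s = "A + A'"
      have s: "?s > 0" using False d e by linarith
      have w: "A / ?s + A' / ?s = 1" using s by (simp add: add_divide_distrib[symmetric])
      have "(A / ?s) *\<^sub>R y + (A' / ?s) *\<^sub>R y' \<in> F" "(A / ?s) *\<^sub>R z + (A' / ?s) *\<^sub>R z' \<in> F"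
        using assms(1) d e s w unfolding convex_def by simp_all
      moreover have "d + e = ?s *\<^sub>R (((A / ?s) *\<^sub>R y + (A' / ?s) *\<^sub>R y') - ((A / ?s) *\<^sub>R z + (A' / ?s) *\<^sub>R z'))"
        using s d e by (simp add: scaleR_right_diff_distrib scaleR_add_right)
      ultimately show ?thesis using less_imp_le[OF s] by blast
    qed
  next
    fix c :: real and d assume "d \<in> ?R"
    then obtain A y z where d: "A \<ge> 0" "y \<in> F" "z \<in> F" "d = A *\<^sub>R (y - z)" by blast
    show "c *\<^sub>R d \<in> ?R"
    proof (cases "c \<ge> 0")
      case True
      then have "c *\<^sub>R d = (c * A) *\<^sub>R (y - z)" "c * A \<ge> 0" using d by auto
      then show ?thesis using d by blast
    next
      case False
      have "c *\<^sub>R d = ((- c) * A) *\<^sub>R (z - y)"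
        using d by (simp add: scaleR_right_diff_distrib)
      moreover have "(- c) * A \<ge> 0" using False d by (simp add: mult_nonpos_nonneg)
      ultimately show ?thesis using d by blast
    qed
  qed
  moreover have "{x - y |x y. x \<in> F \<and> y \<in> F} \<subseteq> ?R"
    by (auto intro!: exI[of _ "1::real"])
  ultimately show ?thesis using span_minimal assms(3) by blast
qed

text \<open>
  If \<open>x - f = A (y - z)\<close> with \<open>f, y, z \<in> F\<close>, then \<open>x + A z = f + A y\<close>. After division by \<open>1 + A\<close> the
  right-hand side is a point of \<open>F\<close> and the left-hand side lies between \<open>x\<close> and \<open>z\<close>, so the face property
  puts \<open>x\<close> into \<open>F\<close>.
\<close>

lemma face_of_absorbs_span:
  fixes S :: "'a::real_vector set"
  assumes F: "F face_of S" and f: "f \<in> F" and x: "x \<in> S"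
    and d: "x - f \<in> span {x - y |x y. x \<in> F \<and> y \<in> F}"
  shows "x \<in> F"
proof -
  have cF: "convex F" using F face_of_imp_convex by blast
  obtain A y z where A: "A \<ge> 0" "y \<in> F" "z \<in> F" "x - f = A *\<^sub>R (y - z)"
    using span_differences_convex[OF cF _ d] f by blast
  show ?thesis
  proof (cases "A = 0 \<or> x = z")
    case True
    then show ?thesis using A f by auto
  next
    case False
    then have A0: "A > 0" and xz: "x \<noteq> z" using A by auto
    let ?m = "(1 / (1 + A)) *\<^sub>R f + (A / (1 + A)) *\<^sub>R y"
    have sum1: "1 / (1 + A) + A / (1 + A) = 1" using A0 by (simp add: add_divide_distrib[symmetric])
    have m: "?m \<in> F" using cF f A A0 sum1 unfolding convex_def by simp
    have "x = f + A *\<^sub>R (y - z)" using A by (simp add: algebra_simps)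
    then have mx: "?m = (1 / (1 + A)) *\<^sub>R x + (A / (1 + A)) *\<^sub>R z"
      using A0 by (simp add: scaleR_right_diff_distrib scaleR_add_right)
    have "1 / (1 + A) = 1 - A / (1 + A)" using sum1 by linarith
    then have "?m \<in> open_segment x z"
      using A0 xz mx unfolding in_segment by (auto intro!: exI[of _ "A / (1 + A)"])
    moreover have "z \<in> S" using A F face_of_imp_subset by blast
    ultimately show ?thesis using F m x unfolding face_of_def by blast
  qed
qed

text \<open>
  The function \<^const>\<open>dim\<close> counts the vectors of a basis only in finite dimension, hence the bound by \<open>span C\<close> here and below.
\<close>

lemma nested_bases:
  fixes A B :: "'a::real_vector set"
  assumes "A \<subseteq> B" "B \<subseteq> span C" "finite C"
  obtains a c where "a \<subseteq> c" "c \<subseteq> B" "finite c"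
    and "a \<subseteq> A" "A \<subseteq> span a" "card a = dim A" "B \<subseteq> span c" "card c = dim B"
proof -
  obtain a where a: "a \<subseteq> A" "independent a" "A \<subseteq> span a" "card a = dim A"
    using basis_exists[of A] by blast
  obtain c where c: "a \<subseteq> c" "c \<subseteq> B" "independent c" "B \<subseteq> span c"
    using maximal_independent_subset_extend[of a B] a assms(1) by blast
  have "finite c" using independent_span_bound[OF assms(3) c(3)] c assms(2) by blast
  moreover have "card c = dim B" using basis_card_eq_dim[OF c(2,4,3)] by simp
  ultimately show ?thesis using that a c by blast
qed

lemma span_eq_if_dim_eq:
  fixes A B :: "'a::real_vector set"
  assumes "A \<subseteq> B" "dim A = dim B" "B \<subseteq> span C" "finite C"
  shows "span A = span B"
proof -
  obtain a c where ac: "a \<subseteq> c" "finite c" "card a = dim A" "card c = dim B"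
    and sp: "a \<subseteq> A" "B \<subseteq> span c"
    using nested_bases[OF assms(1,3,4)] by metis
  have "a = c" using ac assms(2) by (metis card_subset_eq)
  then have "B \<subseteq> span A" using sp by (metis span_mono subset_trans)
  then show ?thesis using assms(1) by (metis span_mono span_minimal subspace_span subset_antisym)
qed

lemma dim_mono_finite:
  fixes A B :: "'a::real_vector set"
  assumes "A \<subseteq> B" "B \<subseteq> span C" "finite C"
  shows "dim A \<le> dim B"
  using nested_bases[OF assms] by (metis card_mono)

lemma differences_subset_span:
  assumes "S \<subseteq> span C"
  shows "{x - y |x y. x \<in> S \<and> y \<in> S} \<subseteq> span C"
  using assms by (auto intro!: span_diff)

lemma affine_dimension_mono:
  assumes "S \<subseteq> T" "T \<subseteq> span C" "finite C"
  shows "affine_dimension S \<le> affine_dimension T"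
proof -
  have "dim {x - y |x y. x \<in> S \<and> y \<in> S} \<le> dim {x - y |x y. x \<in> T \<and> y \<in> T}"
    by (rule dim_mono_finite[OF _ differences_subset_span[OF assms(2)] assms(3)])
      (use assms(1) in blast)
  then show ?thesis using assms(1) by (auto simp: affine_dimension_def)
qed

text \<open>
  Equal dimensions make the difference spaces of \<open>F\<close> and \<open>S\<close> equal, and a face absorbs every point of \<open>S\<close>
  that it reaches within its own difference space.
\<close>

lemma face_eq_if_affine_dimension_eq:
  assumes F: "F face_of S" and ne: "F \<noteq> {}" and SC: "S \<subseteq> span C" "finite C"
    and eq: "affine_dimension F = affine_dimension S"
  shows "F = S"
proof -
  have sub: "F \<subseteq> S" using F face_of_imp_subset by blast
  have "dim {x - y |x y. x \<in> F \<and> y \<in> F} = dim {x - y |x y. x \<in> S \<and> y \<in> S}"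
    using eq ne sub by (auto simp: affine_dimension_def split: if_splits)
  then have sp: "span {x - y |x y. x \<in> F \<and> y \<in> F} = span {x - y |x y. x \<in> S \<and> y \<in> S}"
    by (intro span_eq_if_dim_eq[OF _ _ differences_subset_span[OF SC(1)] SC(2)]) (use sub in blast)+
  obtain f where f: "f \<in> F" using ne by blast
  have "x \<in> F" if "x \<in> S" for x
  proof (rule face_of_absorbs_span[OF F f that])
    show "x - f \<in> span {x - y |x y. x \<in> F \<and> y \<in> F}"
      unfolding sp using that f sub by (intro span_base) blast
  qed
  then show ?thesis using sub by blast
qed

section \<open>Facets of a knapsack slice of the cube\<close>

lemma inner_prod_add: "inner_prod n p (x + y) = inner_prod n p x + inner_prod n p y"
  by (simp add: inner_prod_def sum.distrib algebra_simps)

lemma inner_prod_scaleR: "inner_prod n p (c *\<^sub>R x) = c * inner_prod n p x"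
  by (simp add: inner_prod_def sum_distrib_left algebra_simps)

lemma inner_prod_diff: "inner_prod n p (x - y) = inner_prod n p x - inner_prod n p y"
  by (simp add: inner_prod_def sum_subtractf algebra_simps)

definition knapsack :: "nat \<Rightarrow> (nat \<Rightarrow> real) \<Rightarrow> real \<Rightarrow> (nat \<Rightarrow> real) set" where
  "knapsack n w b = {x \<in> unit_cube n. inner_prod n w x = b}"

lemma knapsackI:
  assumes "\<And>i. i \<ge> n \<Longrightarrow> x i = 0" "\<And>i. i < n \<Longrightarrow> 0 \<le> x i \<and> x i \<le> 1" "inner_prod n w x = b"
  shows "x \<in> knapsack n w b"
  using assms by (auto simp: knapsack_def unit_cube_def real_vectors_def)

lemma knapsackD:
  assumes "x \<in> knapsack n w b"
  shows "i \<ge> n \<Longrightarrow> x i = 0" "0 \<le> x i" "x i \<le> 1" "inner_prod n w x = b"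
  using assms by (cases "i < n"; auto simp: knapsack_def unit_cube_def real_vectors_def)+

lemma convex_knapsack: "convex (knapsack n w b)"
proof (rule convexI)
  fix x y and u v :: real
  assume xy: "x \<in> knapsack n w b" "y \<in> knapsack n w b" and uv: "0 \<le> u" "0 \<le> v" "u + v = 1"
  note D = knapsackD[OF xy(1)] knapsackD[OF xy(2)]
  show "u *\<^sub>R x + v *\<^sub>R y \<in> knapsack n w b"
  proof (rule knapsackI)
    show "(u *\<^sub>R x + v *\<^sub>R y) i = 0" if "i \<ge> n" for i
      using that D by simp
    show "0 \<le> (u *\<^sub>R x + v *\<^sub>R y) i \<and> (u *\<^sub>R x + v *\<^sub>R y) i \<le> 1" for i
      using knapsackD(2,3)[OF xy(1), of i] knapsackD(2,3)[OF xy(2), of i] uv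
        mult_left_le[of "x i" u] mult_left_le[of "y i" v] by simp
    show "inner_prod n w (u *\<^sub>R x + v *\<^sub>R y) = b"
      using D uv by (simp add: inner_prod_add inner_prod_scaleR flip: distrib_right)
  qed
qed

lemma knapsack_subset_span:
  "knapsack n w b \<subseteq> span ((\<lambda>i. (\<lambda>j. if j = i then 1 else 0)) ` {..<n})"
proof
  fix x assume x: "x \<in> knapsack n w b"
  have "x = (\<Sum>i<n. x i *\<^sub>R (\<lambda>j. if j = i then 1 else 0))"
  proof
    fix j
    have "(\<Sum>i<n. x i *\<^sub>R (\<lambda>j. if j = i then 1 else (0::real))) j = (\<Sum>i<n. if j = i then x i else 0)"
      by (induction n) (auto)
    also have "\<dots> = x j" using knapsackD(1)[OF x, of j] by auto
    finally show "x j = (\<Sum>i<n. x i *\<^sub>R (\<lambda>j. if j = i then 1 else 0)) j" by simp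
  qed
  then show "x \<in> span ((\<lambda>i. (\<lambda>j. if j = i then 1 else 0)) ` {..<n})"
    by (metis (no_types, lifting) span_sum span_scale span_base imageI)
qed

text \<open>
  The face on which one cube inequality is tight: \<open>x i = 1\<close> for the index \<open>(i, True)\<close>, and \<open>x i = 0\<close> for the
  index \<open>(i, False)\<close>.
\<close>

definition pinned :: "(nat \<Rightarrow> real) set \<Rightarrow> nat \<times> bool \<Rightarrow> (nat \<Rightarrow> real) set" where
  "pinned P c = {x \<in> P. x (fst c) = of_bool (snd c)}"

lemma pinned_face_of_knapsack: "pinned (knapsack n w b) c face_of knapsack n w b"
proof -
  let ?P = "knapsack n w b"
  obtain i e where c: "c = (i, e)" by (cases c)
  have cv: "convex (pinned ?P c)"
  proof (rule convexI)
    fix x y and u v :: real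
    assume xy: "x \<in> pinned ?P c" "y \<in> pinned ?P c" and uv: "0 \<le> u" "0 \<le> v" "u + v = 1"
    have "u *\<^sub>R x + v *\<^sub>R y \<in> ?P"
      using xy uv convex_knapsack by (auto simp: pinned_def intro!: convexD)
    then show "u *\<^sub>R x + v *\<^sub>R y \<in> pinned ?P c"
      using xy uv by (auto simp: pinned_def)
  qed
  have ends: "x i = of_bool e \<and> y i = of_bool e"
    if x: "x \<in> ?P" and y: "y \<in> ?P" and u: "0 < u" "u < 1" and z: "(1 - u) * x i + u * y i = of_bool e"
    for x y and u :: real
  proof -
    note B = knapsackD(2,3)[OF x, of i] knapsackD(2,3)[OF y, of i]
    have *: "\<not> (r > 0 \<or> q > 0)" if "0 \<le> r" "0 \<le> q" "(1 - u) * r + u * q = 0" for r q :: real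
      using that u by (smt (verit) mult_pos_pos mult_nonneg_nonneg)
    show ?thesis
    proof (cases e)
      case True
      then show ?thesis using *[of "1 - x i" "1 - y i"] B z by (auto simp: algebra_simps)
    next
      case False
      then show ?thesis using *[of "x i" "y i"] B z by auto
    qed
  qed
  show ?thesis
    unfolding face_of_def
  proof (intro conjI ballI impI)
    show "pinned ?P c \<subseteq> ?P" by (auto simp: pinned_def)
    show "convex (pinned ?P c)" by (rule cv)
    fix x y z assume xy: "x \<in> ?P" "y \<in> ?P" and z: "z \<in> pinned ?P c" and zs: "z \<in> open_segment x y"
    obtain u where u: "0 < u" "u < 1" "z = (1 - u) *\<^sub>R x + u *\<^sub>R y"
      using zs by (auto simp: in_segment)
    have "(1 - u) * x i + u * y i = of_bool e"
      using z u c by (simp add: pinned_def)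
    with ends[OF xy u(1,2)] show "x \<in> pinned ?P c" "y \<in> pinned ?P c"
      using xy c by (auto simp: pinned_def)
  qed
qed

text \<open>
  Each cube inequality that is not tight on all of \<open>F\<close> is strict at some point of \<open>F\<close>; averaging these
  points gives \<open>f \<in> F\<close> at which all of them are strict at once. From \<open>f\<close> one can therefore step a little away
  from \<open>x\<close> without leaving the knapsack slice, which places \<open>f\<close> strictly between \<open>x\<close> and another point
  of the slice.
\<close>

lemma face_of_knapsack_determined_by_pins:
  assumes F: "F face_of knapsack n w b" "F \<noteq> {}"
    and x: "x \<in> knapsack n w b"
    and pins: "\<And>c. fst c < n \<Longrightarrow> F \<subseteq> pinned (knapsack n w b) c \<Longrightarrow> x \<in> pinned (knapsack n w b) c"
  shows "x \<in> F"
proof -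
  let ?P = "knapsack n w b"
  have FP: "F \<subseteq> ?P" using F(1) face_of_imp_subset by blast
  have avoid: "\<exists>f\<in>F. \<forall>c\<in>C. f \<notin> pinned ?P c" if "finite C" "\<forall>c\<in>C. \<not> F \<subseteq> pinned ?P c" for C
    using that
  proof (induction C rule: finite_induct)
    case empty
    then show ?case using F(2) by blast
  next
    case (insert c C)
    then obtain f g where f: "f \<in> F" "\<forall>c\<in>C. f \<notin> pinned ?P c" and g: "g \<in> F" "g \<notin> pinned ?P c"
      by auto
    let ?m = "(1/2::real) *\<^sub>R f + (1/2::real) *\<^sub>R g"
    have mF: "?m \<in> F" using F(1) f(1) g(1) face_of_imp_convex by (intro convexD) auto
    have m: "f \<in> pinned ?P d \<and> g \<in> pinned ?P d" if d: "?m \<in> pinned ?P d" for d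
    proof (cases "f = g")
      case True
      then show ?thesis using d by (simp flip: scaleR_left_distrib)
    next
      case False
      then have "?m \<in> open_segment f g"
        unfolding in_segment by (intro conjI exI[of _ "1/2"]) auto
      then show ?thesis
        using face_ofD[OF pinned_face_of_knapsack _ _ _ d] f(1) g(1) FP by blast
    qed
    show ?case using m mF f g by blast
  qed
  let ?C = "{c \<in> {..<n} \<times> UNIV. \<not> F \<subseteq> pinned ?P c}"
  have "finite ?C" by (rule finite_subset[of _ "{..<n} \<times> UNIV"]) auto
  moreover have "\<forall>c\<in>?C. \<not> F \<subseteq> pinned ?P c" by blast
  ultimately obtain f where f: "f \<in> F" and fC: "\<forall>c\<in>?C. f \<notin> pinned ?P c"
    using avoid by blast
  have fP: "f \<in> ?P" using f FP by blast
  have room: "x i = f i" if i: "i < n" "f i = 0 \<or> f i = 1" for i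
  proof -
    have fp: "f \<in> pinned ?P (i, f i = 1)" using i fP by (auto simp: pinned_def)
    have "(i, f i = 1) \<notin> ?C" using fC fp by blast
    then have "F \<subseteq> pinned ?P (i, f i = 1)" using i by auto
    then have "x \<in> pinned ?P (i, f i = 1)" using pins[of "(i, f i = 1)"] i by simp
    then show ?thesis using fp by (simp add: pinned_def)
  qed
  show ?thesis
  proof (cases "x = f")
    case True
    then show ?thesis using f by simp
  next
    case False
    \<comment> \<open>coordinates of \<open>f\<close> at a bound agree with those of \<open>x\<close> and do not limit the step\<close>
    let ?r = "\<lambda>i. if f i = 0 \<or> f i = 1 then 1 else min (f i) (1 - f i)"
    define t where "t = Min (insert 1 (?r ` {..<n}))"
    note Bf = knapsackD(2,3)[OF fP] and Bx = knapsackD(2,3)[OF x]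
    have r0: "?r i > 0" for i using Bf[of i] by (auto simp: less_le)
    have t0: "t > 0" unfolding t_def using r0 by (subst Min_gr_iff) (simp, simp, blast intro: zero_less_one)
    have tr: "t \<le> ?r i" if "i < n" for i unfolding t_def using that by (intro Min_le) auto
    let ?y = "f + t *\<^sub>R (f - x)"
    have y: "?y \<in> ?P"
    proof (rule knapsackI)
      show "?y i = 0" if "i \<ge> n" for i using that knapsackD(1)[OF fP] knapsackD(1)[OF x] by simp
      have "inner_prod n w ?y = inner_prod n w f + t * (inner_prod n w f - inner_prod n w x)"
        by (simp only: inner_prod_add inner_prod_diff inner_prod_scaleR)
      then show "inner_prod n w ?y = b"
        unfolding knapsackD(4)[OF fP] knapsackD(4)[OF x] by simp
      show "0 \<le> ?y i \<and> ?y i \<le> 1" if i: "i < n" for i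
      proof (cases "f i = 0 \<or> f i = 1")
        case True
        then show ?thesis using room[OF i True] by auto
      next
        case False
        then have "t \<le> f i" "t \<le> 1 - f i" using tr[OF i] by auto
        moreover have "\<bar>f i - x i\<bar> \<le> 1" using Bf[of i] Bx[of i] by linarith
        then have "\<bar>t * (f i - x i)\<bar> \<le> t" using t0 by (simp add: abs_mult mult_left_le)
        ultimately have "0 \<le> f i + t * (f i - x i)" "f i + t * (f i - x i) \<le> 1" by linarith+
        then show ?thesis by simp
      qed
    qed
    have "f \<in> open_segment x ?y"
      unfolding in_segment
    proof (intro conjI exI[of _ "1 / (1 + t)"])
      have "?y - x = (1 + t) *\<^sub>R (f - x)" by (simp add: algebra_simps)
      then show "x \<noteq> ?y" using t0 False by force
      show "f = (1 - 1 / (1 + t)) *\<^sub>R x + (1 / (1 + t)) *\<^sub>R ?y"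
      proof
        fix i
        have "f i = (1 - 1 / (1 + t)) * x i + 1 / (1 + t) * (f i + t * (f i - x i))"
          using t0 by (simp add: divide_simps) (simp add: algebra_simps)
        then show "f i = ((1 - 1 / (1 + t)) *\<^sub>R x + (1 / (1 + t)) *\<^sub>R ?y) i" by simp
      qed
    qed (use t0 in auto)
    then show ?thesis using face_ofD[OF F(1) _ x y f] by blast
  qed
qed

text \<open>
  A facet lies in some pinned face that is not the whole slice; its dimension leaves no room between the two,
  so the facet is that pinned face.
\<close>

lemma facets_knapsack_subset: "facets (knapsack n w b) \<subseteq> pinned (knapsack n w b) ` ({..<n} \<times> UNIV)"
proof
  let ?P = "knapsack n w b"
  fix F assume "F \<in> facets ?P"
  then have F: "F face_of ?P" "F \<noteq> {}" "affine_dimension F = affine_dimension ?P - 1"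
    by (auto simp: facets_def)
  note sp = knapsack_subset_span[of n w b]
  have FP: "F \<subseteq> ?P" using F(1) face_of_imp_subset by blast
  have "F \<noteq> ?P" using F(3) by auto
  then obtain x where x: "x \<in> ?P" "x \<notin> F" using FP by blast
  then obtain c where c: "fst c < n" "F \<subseteq> pinned ?P c" "x \<notin> pinned ?P c"
    using face_of_knapsack_determined_by_pins[OF F(1,2) x(1)] by blast
  have QP: "pinned ?P c \<subseteq> ?P" by (auto simp: pinned_def)
  have "affine_dimension (pinned ?P c) \<noteq> affine_dimension ?P"
    using face_eq_if_affine_dimension_eq[OF pinned_face_of_knapsack _ sp] x c F(2) by blast
  moreover have "affine_dimension (pinned ?P c) \<le> affine_dimension ?P"
    by (rule affine_dimension_mono[OF QP sp]) simp
  moreover have "affine_dimension F \<le> affine_dimension (pinned ?P c)"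
    by (rule affine_dimension_mono[OF c(2) order_trans[OF QP sp]]) simp
  ultimately have "affine_dimension F = affine_dimension (pinned ?P c)" using F(3) by linarith
  moreover have "F face_of pinned ?P c" by (rule face_of_subset[OF F(1) c(2) QP])
  ultimately have "F = pinned ?P c"
    using face_eq_if_affine_dimension_eq[OF _ F(2) order_trans[OF QP sp]] by blast
  then show "F \<in> pinned ?P ` ({..<n} \<times> UNIV)" using c(1) by (cases c) auto
qed

lemma card_facets_knapsack:
  "finite (facets (knapsack n w b))" "card (facets (knapsack n w b)) \<le> 2 * n"
proof -
  let ?I = "pinned (knapsack n w b) ` ({..<n} \<times> UNIV)"
  have fin: "finite ?I" by simp
  show "finite (facets (knapsack n w b))"
    using facets_knapsack_subset fin by (rule finite_subset)
  have "card (facets (knapsack n w b)) \<le> card ?I"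
    using facets_knapsack_subset fin by (rule card_mono[rotated])
  also have "\<dots> \<le> card ({..<n} \<times> (UNIV :: bool set))" by (rule card_image_le) simp
  finally show "card (facets (knapsack n w b)) \<le> 2 * n" by (simp add: card_cartesian_product)
qed

section \<open>Vertices of a knapsack slice\<close>

text \<open>
  The vector that follows \<open>v\<close> on \<open>F\<close> and has one common value on the other coordinates, chosen such that
  the \<open>w\<close>-weighted sum is \<open>b\<close>. It serves two purposes. With a single coordinate outside \<open>F\<close> and 0/1 values on
  \<open>F\<close> it describes the vertices of the knapsack slice; with few coordinates in \<open>F\<close> it describes the points that
  survive many rounds of split cuts.
\<close>

definition balanced_point :: "nat \<Rightarrow> (nat \<Rightarrow> real) \<Rightarrow> real \<Rightarrow> nat set \<Rightarrow> (nat \<Rightarrow> real) \<Rightarrow> nat \<Rightarrow> real" where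
  "balanced_point n w b F v = (\<lambda>i. if i \<in> F then v i
     else if i < n then (b - (\<Sum>j\<in>F. w j * v j)) / (\<Sum>j\<in>{..<n} - F. w j) else 0)"

lemma inner_prod_balanced_point_general:
  assumes "F \<subseteq> {..<n}"
  shows "inner_prod n p (balanced_point n w b F v) = (\<Sum>j\<in>F. p j * v j) +
    (b - (\<Sum>j\<in>F. w j * v j)) / (\<Sum>j\<in>{..<n} - F. w j) * (\<Sum>j\<in>{..<n} - F. p j)"
proof -
  have "inner_prod n p (balanced_point n w b F v) =
      (\<Sum>j\<in>F. p j * balanced_point n w b F v j) + (\<Sum>j\<in>{..<n} - F. p j * balanced_point n w b F v j)"
    unfolding inner_prod_def using sum.subset_diff[OF assms, of "\<lambda>j. p j * balanced_point n w b F v j"]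
    by simp
  also have "(\<Sum>j\<in>F. p j * balanced_point n w b F v j) = (\<Sum>j\<in>F. p j * v j)"
    by (simp add: balanced_point_def)
  also have "(\<Sum>j\<in>{..<n} - F. p j * balanced_point n w b F v j) =
      (b - (\<Sum>j\<in>F. w j * v j)) / (\<Sum>j\<in>{..<n} - F. w j) * (\<Sum>j\<in>{..<n} - F. p j)"
    unfolding sum_distrib_left by (intro sum.cong) (auto simp: balanced_point_def)
  finally show ?thesis .
qed

lemma inner_prod_balanced_point:
  assumes "F \<subseteq> {..<n}" "(\<Sum>j\<in>{..<n} - F. w j) \<noteq> 0"
  shows "inner_prod n w (balanced_point n w b F v) = b"
  using inner_prod_balanced_point_general[OF assms(1), of w w b v] assms(2) by simp

definition fractional :: "nat \<Rightarrow> (nat \<Rightarrow> real) \<Rightarrow> nat set" where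
  "fractional n x = {i \<in> {..<n}. x i \<noteq> 0 \<and> x i \<noteq> 1}"

text \<open>
  As long as two coordinates \<open>i\<close> and \<open>j\<close> are fractional, the point can be moved both ways along the direction
  \<open>w j e\<^sub>i - w i e\<^sub>j\<close>, which keeps the weighted sum, until one of the two coordinates becomes integral. The point
  lies between the two ends, and both ends have fewer fractional coordinates.
\<close>

lemma knapsack_in_hull_of_nearly_integral:
  assumes w: "\<And>i. i < n \<Longrightarrow> w i > 0" and x: "x \<in> knapsack n w b"
  shows "x \<in> convex hull {y \<in> knapsack n w b. card (fractional n y) \<le> 1}"
  using x
proof (induction "card (fractional n x)" arbitrary: x rule: less_induct)
  case less
  let ?P = "knapsack n w b"
  let ?H = "convex hull {y \<in> ?P. card (fractional n y) \<le> 1}"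
  have fin: "finite (fractional n y)" for y by (simp add: fractional_def)
  show ?case
  proof (cases "card (fractional n x) \<le> 1")
    case True
    then show ?thesis using less.prems by (intro hull_inc) simp
  next
    case False
    then obtain i j where ij: "i \<in> fractional n x" "j \<in> fractional n x" "i \<noteq> j"
      by (metis One_nat_def card_le_Suc0_iff_eq fin)
    note B = knapsackD(2,3)[OF less.prems]
    have lt: "0 < x k \<and> x k < 1 \<and> 0 < w k \<and> k < n" if "k \<in> fractional n x" for k
      using that B[of k] w by (auto simp: fractional_def less_le)
    have step: "\<exists>t>0. x + t *\<^sub>R (\<lambda>k. if k = p then w q else if k = q then - w p else 0) \<in> ?H"
      if fr: "p \<in> fractional n x" "q \<in> fractional n x" and pq: "p \<noteq> q" for p q
    proof -
      define d where "d = (\<lambda>k. if k = p then w q else if k = q then - w p else 0)"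
      \<comment> \<open>the largest step for which \<open>x p\<close> stays at most 1 and \<open>x q\<close> stays nonnegative\<close>
      define t where "t = min ((1 - x p) / w q) (x q / w p)"
      define y where "y = x + t *\<^sub>R d"
      have P: "0 < x p" "x p < 1" "0 < w p" "p < n" and Q: "0 < x q" "x q < 1" "0 < w q" "q < n"
        using lt[OF fr(1)] lt[OF fr(2)] by blast+
      have t0: "t > 0" using P Q by (simp add: t_def)
      have y_other: "y k = x k" if "k \<noteq> p" "k \<noteq> q" for k using that by (simp add: y_def d_def)
      have yp: "y p = x p + t * w q" and yq: "y q = x q - t * w p"
        using pq by (auto simp: y_def d_def)
      have "t * w q \<le> (1 - x p) / w q * w q" "t * w p \<le> x q / w p * w p"
        using P Q by (intro mult_right_mono; simp add: t_def)+
      then have le: "t * w q \<le> 1 - x p" "t * w p \<le> x q" using P Q by auto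
      have pos: "t * w q \<ge> 0" "t * w p \<ge> 0" using P Q t0 by auto
      have yP: "y \<in> ?P"
      proof (rule knapsackI)
        show "y k = 0" if "k \<ge> n" for k
          using that y_other[of k] knapsackD(1)[OF less.prems that] P Q by auto
        show "0 \<le> y k \<and> y k \<le> 1" if "k < n" for k
        proof (cases "k = p \<or> k = q")
          case True
          then show ?thesis using yp yq le pos P Q by auto
        next
          case False
          then show ?thesis using y_other B by auto
        qed
        have "inner_prod n w d = (\<Sum>k<n. (if k = p then w p * w q else 0) + (if k = q then - (w q * w p) else 0))"
          unfolding inner_prod_def d_def using pq by (intro sum.cong) auto
        also have "\<dots> = 0" using P Q by (simp add: sum.distrib)
        finally have d0: "inner_prod n w d = 0" .
        have "inner_prod n w y = inner_prod n w x + t * inner_prod n w d"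
          unfolding y_def by (simp only: inner_prod_add inner_prod_scaleR)
        then show "inner_prod n w y = b" using d0 knapsackD(4)[OF less.prems] by simp
      qed
      have hit: "y p = 1 \<or> y q = 0"
        using P Q yp yq by (auto simp: t_def min_def)
      have sub: "fractional n y \<subseteq> fractional n x"
      proof
        fix k assume "k \<in> fractional n y"
        then show "k \<in> fractional n x"
          using y_other[of k] fr by (cases "k = p \<or> k = q") (auto simp: fractional_def)
      qed
      have "p \<notin> fractional n y \<or> q \<notin> fractional n y" using hit by (auto simp: fractional_def)
      then have "fractional n y \<subset> fractional n x" using fr sub by blast
      then have "card (fractional n y) < card (fractional n x)" using fin by (intro psubset_card_mono)
      from less.hyps[OF this yP] t0 show ?thesis unfolding y_def d_def by blast
    qed
    let ?d = "\<lambda>p q k. if k = p then w q else if k = q then - w p else 0"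
    obtain t where t: "t > 0" "x + t *\<^sub>R ?d i j \<in> ?H" using step[of i j] ij by blast
    obtain s where s: "s > 0" "x + s *\<^sub>R ?d j i \<in> ?H" using step[of j i] ij by blast
    have neg: "?d j i k = - ?d i j k" for k using ij(3) by auto
    have "(s / (s + t)) *\<^sub>R (x + t *\<^sub>R ?d i j) + (t / (s + t)) *\<^sub>R (x + s *\<^sub>R ?d j i) \<in> ?H"
      using s t by (intro convexD[OF convex_convex_hull]) (auto simp flip: add_divide_distrib)
    also have "(s / (s + t)) *\<^sub>R (x + t *\<^sub>R ?d i j) + (t / (s + t)) *\<^sub>R (x + s *\<^sub>R ?d j i) = x"
    proof
      fix k
      have "s / (s + t) * (x k + t * e) + t / (s + t) * (x k + s * - e) = x k" for e
        using s t by (simp add: divide_simps) (simp add: algebra_simps)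
      then show "((s / (s + t)) *\<^sub>R (x + t *\<^sub>R ?d i j) + (t / (s + t)) *\<^sub>R (x + s *\<^sub>R ?d j i)) k = x k"
        unfolding plus_fun_apply scaleR_fun_apply neg[of k] real_scaleR_def by blast
    qed
    finally show ?thesis .
  qed
qed

text \<open>
  All coordinates but one are 0 or 1, and they determine the remaining one through the weighted sum.
\<close>

lemma knapsack_nearly_integral_finite:
  assumes w: "\<And>i. i < n \<Longrightarrow> w i > 0" and n: "n > 0"
  shows "finite {y \<in> knapsack n w b. card (fractional n y) \<le> 1}" (is "finite ?V")
proof -
  let ?g = "\<lambda>(i, T). balanced_point n w b ({..<n} - {i}) (\<lambda>j. of_bool (j \<in> T))"
  have "?V \<subseteq> ?g ` ({..<n} \<times> Pow {..<n})"
  proof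
    fix x assume "x \<in> ?V"
    then have x: "x \<in> knapsack n w b" and c: "card (fractional n x) \<le> 1" by auto
    have "finite (fractional n x)" by (simp add: fractional_def)
    then have "\<forall>j\<in>fractional n x. \<forall>k\<in>fractional n x. j = k"
      using c card_le_Suc0_iff_eq by (metis One_nat_def)
    then obtain i where i: "i < n" "fractional n x \<subseteq> {i}"
    proof (cases "fractional n x = {}")
      case False
      then obtain k where "k \<in> fractional n x" by blast
      then have "k < n" "fractional n x \<subseteq> {k}"
        using \<open>\<forall>j\<in>_. _\<close> by (auto simp: fractional_def)
      then show ?thesis using that by blast
    qed (use n in blast)
    define T where "T = {j. j < n \<and> x j = 1}"
    let ?F = "{..<n} - {i}" and ?v = "\<lambda>j. of_bool (j \<in> T) :: real"
    have xv: "x j = ?v j" if "j \<in> ?F" for j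
      using i that by (auto simp: fractional_def T_def)
    have "b = (\<Sum>j\<in>?F. w j * x j) + w i * x i"
      using knapsackD(4)[OF x] i(1) by (simp add: inner_prod_def sum.remove[of "{..<n}" i])
    moreover have "(\<Sum>j\<in>?F. w j * x j) = (\<Sum>j\<in>?F. w j * ?v j)"
      by (intro sum.cong refl) (simp only: xv)
    ultimately have "b - (\<Sum>j\<in>?F. w j * ?v j) = w i * x i" by linarith
    moreover have "{..<n} - ?F = {i}" using i by auto
    ultimately have "x = balanced_point n w b ?F ?v"
      unfolding balanced_point_def using xv w[OF i(1)] i knapsackD(1)[OF x]
      by (auto simp: fun_eq_iff)
    then have "x = ?g (i, T)" by simp
    moreover have "T \<in> Pow {..<n}" by (auto simp: T_def)
    ultimately have "\<exists>e\<in>{..<n} \<times> Pow {..<n}. x = ?g e" using i(1) by blast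
    then show "x \<in> ?g ` ({..<n} \<times> Pow {..<n})" by blast
  qed
  then show ?thesis by (rule finite_subset) simp
qed

lemma polytope_knapsack:
  assumes w: "\<And>i. i < n \<Longrightarrow> w i > 0" and n: "n > 0"
  shows "polytope (knapsack n w b)"
proof -
  let ?V = "{y \<in> knapsack n w b. card (fractional n y) \<le> 1}"
  have "knapsack n w b \<subseteq> convex hull ?V"
    using knapsack_in_hull_of_nearly_integral w by blast
  moreover have "convex hull ?V \<subseteq> knapsack n w b"
    by (rule hull_minimal[where S=convex, OF _ convex_knapsack]) blast
  ultimately have "knapsack n w b = convex hull ?V" by blast
  then show ?thesis unfolding polytope_def using knapsack_nearly_integral_finite[of n w b] w n by blast
qed

section \<open>Points that survive split cuts\<close>

lemma balanced_point_cong: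
  assumes "\<And>i. i \<in> F \<Longrightarrow> v i = v' i"
  shows "balanced_point n w b F v = balanced_point n w b F v'"
  using assms by (auto simp: balanced_point_def fun_eq_iff intro!: arg_cong2[where f="(/)"] sum.cong)

lemma balanced_point_affine:
  "balanced_point n w b F (\<lambda>i. (1 - u) * v i + u * v' i) =
    (1 - u) *\<^sub>R balanced_point n w b F v + u *\<^sub>R balanced_point n w b F v'"
proof
  fix i
  have s: "(\<Sum>j\<in>F. w j * ((1 - u) * v j + u * v' j)) = (1 - u) * (\<Sum>j\<in>F. w j * v j) + u * (\<Sum>j\<in>F. w j * v' j)"
    unfolding sum_distrib_left sum.distrib[symmetric] by (intro sum.cong) (auto simp: algebra_simps)
  have "(b - ((1 - u) * s1 + u * s2)) / W = (1 - u) * ((b - s1) / W) + u * ((b - s2) / W)" for s1 s2 W :: real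
    by (cases "W = 0") (simp_all add: field_simps)
  then show "balanced_point n w b F (\<lambda>i. (1 - u) * v i + u * v' i) i =
    ((1 - u) *\<^sub>R balanced_point n w b F v + u *\<^sub>R balanced_point n w b F v') i"
    by (simp add: balanced_point_def s)
qed

text \<open>
  Enlarging the prescribed set while prescribing the values already taken does not change the common value
  on the rest.
\<close>

lemma balanced_point_extend:
  assumes F: "F \<subseteq> G" and G: "G \<subseteq> {..<n}"
    and W: "(\<Sum>j\<in>{..<n} - F. w j) \<noteq> 0" "(\<Sum>j\<in>{..<n} - G. w j) \<noteq> 0"
  shows "balanced_point n w b G (balanced_point n w b F v) = balanced_point n w b F v"
proof
  fix i
  let ?x = "balanced_point n w b F v" and ?t = "(b - (\<Sum>j\<in>F. w j * v j)) / (\<Sum>j\<in>{..<n} - F. w j)"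
  have "b = (\<Sum>j<n. w j * ?x j)"
    using inner_prod_balanced_point[of F n w b v] F G W by (auto simp: inner_prod_def)
  also have "\<dots> = (\<Sum>j\<in>{..<n} - G. w j * ?x j) + (\<Sum>j\<in>G. w j * ?x j)"
    by (rule sum.subset_diff[OF G]) simp
  also have "(\<Sum>j\<in>{..<n} - G. w j * ?x j) = (\<Sum>j\<in>{..<n} - G. w j) * ?t"
    unfolding sum_distrib_right using F by (intro sum.cong) (auto simp: balanced_point_def)
  finally have eq: "b = (\<Sum>j\<in>{..<n} - G. w j) * ?t + (\<Sum>j\<in>G. w j * ?x j)" .
  have "(b - s) / W = t" if "b = W * t + s" "W \<noteq> 0" for s t W :: real
    using that by simp
  from this[OF eq W(2)]
  have "(b - (\<Sum>j\<in>G. w j * ?x j)) / (\<Sum>j\<in>{..<n} - G. w j) = ?t" .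
  then show "balanced_point n w b G ?x i = ?x i"
    unfolding balanced_point_def[of n w b G] using F G by (auto simp: balanced_point_def)
qed

text \<open>
  For fixed \<open>F\<close> the balanced point depends affinely on \<open>v\<close>, so the fractional entries of \<open>v\<close> can be rounded
  to 0 and 1 one after the other.
\<close>

lemma balanced_point_in_hull_of_binary:
  assumes F: "finite F" and v: "\<And>i. i \<in> F \<Longrightarrow> 0 \<le> v i \<and> v i \<le> 1"
  shows "balanced_point n w b F v \<in> convex hull {balanced_point n w b F z |z. \<forall>i\<in>F. z i \<in> {0, 1}}"
proof -
  let ?H = "convex hull {balanced_point n w b F z |z. \<forall>i\<in>F. z i \<in> {0, 1}}"
  have "balanced_point n w b F v \<in> ?H"
    if "finite T" "T \<subseteq> F" "\<forall>i\<in>F. 0 \<le> v i \<and> v i \<le> 1" "\<forall>i\<in>F - T. v i \<in> {0, 1}" for T v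
    using that
  proof (induction T arbitrary: v rule: finite_induct)
    case empty
    then show ?case by (intro hull_inc) auto
  next
    case (insert k T)
    have "balanced_point n w b F (v(k := e)) \<in> ?H" if "e \<in> {0, 1}" for e
      using insert.prems insert.hyps that by (intro insert.IH) auto
    then have "(1 - v k) *\<^sub>R balanced_point n w b F (v(k := 0)) + v k *\<^sub>R balanced_point n w b F (v(k := 1)) \<in> ?H"
      using insert.prems by (intro convexD[OF convex_convex_hull]) auto
    moreover have v_split: "(\<lambda>i. (1 - v k) * (v(k := 0)) i + v k * (v(k := 1)) i) = v"
      by (auto simp: algebra_simps)
    ultimately show ?case
      using balanced_point_affine[of n w b F "v k" "v(k := 0)" "v(k := 1)"]
      unfolding v_split by (simp only:)
  qed
  from this[of F v] F v show ?thesis by auto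
qed

text \<open>
  The smaller \<open>m\<close>, the more splits these points survive: a round costs a bounded number of coordinates,
  which get prescribed values.
\<close>

definition binary_points :: "nat \<Rightarrow> (nat \<Rightarrow> real) \<Rightarrow> real \<Rightarrow> nat \<Rightarrow> (nat \<Rightarrow> real) set" where
  "binary_points n w b m = {balanced_point n w b F v |F v.
     F \<subseteq> {..<n} \<and> card F \<le> m \<and> (\<forall>i\<in>F. v i \<in> {0, 1})}"

lemma binary_points_mono: "m \<le> m' \<Longrightarrow> binary_points n w b m \<subseteq> binary_points n w b m'"
  unfolding binary_points_def by (blast intro: order_trans)

lemma balanced_point_in_hull_binary_points:
  assumes "F \<subseteq> {..<n}" "card F \<le> m" "\<And>i. i \<in> F \<Longrightarrow> 0 \<le> v i \<and> v i \<le> 1"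
  shows "balanced_point n w b F v \<in> convex hull binary_points n w b m"
proof -
  have "finite F" using assms(1) finite_subset by blast
  from balanced_point_in_hull_of_binary[where v=v and n=n and w=w and b=b, OF this assms(3)]
  have "balanced_point n w b F v \<in> convex hull {balanced_point n w b F z |z. \<forall>i\<in>F. z i \<in> {0, 1}}"
    by blast
  moreover have "{balanced_point n w b F z |z. \<forall>i\<in>F. z i \<in> {0, 1}} \<subseteq> binary_points n w b m"
    using assms(1,2) by (auto simp: binary_points_def)
  ultimately show ?thesis using hull_mono by blast
qed

text \<open>
  The two properties of the weights that defeat split cuts, as long as at most \<open>L\<close> coordinates are
  prescribed. By \<open>central\<close> the common value of the other coordinates stays so far inside \<open>[0, 1]\<close> that a further
  coordinate can be moved by \<open>1/3\<close> in both directions. By \<open>rigid\<close> an integer vector that is close to a real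
  multiple of \<open>w\<close> on almost all coordinates is an integer multiple of \<open>w\<close> there; since \<open>w\<close> and \<open>b\<close> are
  integral, such a vector takes an integer value on every point of the slice whose other coordinates are
  integral, and no split with this normal cuts off such a point.
\<close>

locale robust_knapsack =
  fixes n :: nat and w :: "nat \<Rightarrow> real" and b :: real and L :: nat
  assumes w_int: "i < n \<Longrightarrow> w i \<in> \<int>"
    and w_pos: "i < n \<Longrightarrow> w i > 0"
    and b_int: "b \<in> \<int>"
    and L_less: "L < n"
    and central: "\<lbrakk>F \<subseteq> {..<n}; card F \<le> L; \<And>i. i \<in> F \<Longrightarrow> 0 \<le> v i \<and> v i \<le> 1\<rbrakk> \<Longrightarrow>
      (b - (\<Sum>j\<in>F. w j * v j)) / (\<Sum>j\<in>{..<n} - F. w j) \<in> {1/3..2/3}"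
    and rigid: "\<lbrakk>\<And>i. i < n \<Longrightarrow> p i \<in> \<int>; E \<subseteq> {..<n}; card ({..<n} - E) \<le> L;
      \<And>i. i \<in> E \<Longrightarrow> \<bar>p i - \<rho> * w i\<bar> < 1/44\<rbrakk> \<Longrightarrow> \<exists>c\<in>\<int>. \<forall>i\<in>E. p i = c * w i"
begin

lemma sum_rest_pos:
  assumes "F \<subseteq> {..<n}" "card F \<le> L"
  shows "(\<Sum>j\<in>{..<n} - F. w j) > 0"
proof (rule sum_pos)
  show "{..<n} - F \<noteq> {}"
  proof
    assume "{..<n} - F = {}"
    then have "F = {..<n}" using assms(1) by blast
    then show False using assms(2) L_less by simp
  qed
qed (use w_pos in auto)

lemma binary_points_subset_knapsack: "m \<le> L \<Longrightarrow> binary_points n w b m \<subseteq> knapsack n w b"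
proof
  fix x assume m: "m \<le> L" and "x \<in> binary_points n w b m"
  then obtain F v where x: "x = balanced_point n w b F v" and F: "F \<subseteq> {..<n}" "card F \<le> L"
    and v: "\<forall>i\<in>F. v i \<in> {0, 1}"
    unfolding binary_points_def by auto
  define \<theta> where "\<theta> = (b - (\<Sum>j\<in>F. w j * v j)) / (\<Sum>j\<in>{..<n} - F. w j)"
  have \<theta>: "\<theta> \<in> {1/3..2/3}"
    unfolding \<theta>_def using v by (intro central F) auto
  show "x \<in> knapsack n w b"
  proof (rule knapsackI)
    have xi: "x i = (if i \<in> F then v i else if i < n then \<theta> else 0)" for i
      by (simp add: x balanced_point_def \<theta>_def)
    show "x i = 0" if "i \<ge> n" for i using that F(1) xi by auto
    show "0 \<le> x i \<and> x i \<le> 1" if "i < n" for i using xi[of i] v \<theta> by auto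
    show "inner_prod n w x = b"
      unfolding x using F(1) sum_rest_pos[OF F] by (intro inner_prod_balanced_point) auto
  qed
qed

text \<open>
  Let \<open>u\<close> be the part of the split normal \<open>p\<close> that is not explained by the weights on the free
  coordinates \<open>E\<close>. If some bounded set \<open>S\<close> of free coordinates has \<open>\<bar>u(S)\<bar> \<ge> 3\<close>, then moving \<open>S\<close> by \<open>1/3\<close> up
  or down, and letting the remaining free coordinates compensate, changes \<open>p \<cdot> x\<close> by at least 1 in both
  directions; \<open>x\<close> is the midpoint of two points on the two sides of the split. If there is no such \<open>S\<close>, then
  \<open>u\<close> is tiny off a bounded set \<open>S\<close>, and rigidity applies: once the coordinates in \<open>S\<close> are rounded to 0 and 1,
  the value of \<open>p\<close> is an integer, and \<open>x\<close> is a convex combination of such roundings.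
\<close>

lemma binary_point_survives_split:
  assumes Q: "convex hull binary_points n w b (m + 264) \<subseteq> Q" and m: "m + 264 \<le> L"
    and x: "x \<in> binary_points n w b m" and p: "p \<in> integer_vectors n"
  shows "x \<in> convex hull ({x \<in> Q. inner_prod n p x \<le> of_int p0} \<union> {x \<in> Q. inner_prod n p x \<ge> of_int p0 + 1})"
    (is "x \<in> convex hull ?U")
proof -
  obtain F v where xF: "x = balanced_point n w b F v" and F: "F \<subseteq> {..<n}" "card F \<le> m"
    and v: "\<And>i. i \<in> F \<Longrightarrow> v i \<in> {0, 1}"
    using x unfolding binary_points_def by auto
  have FL: "card F \<le> L" using F m by simp
  have finF: "finite F" using F(1) finite_subset by blast
  define E where "E = {..<n} - F"
  have finE: "finite E" by (simp add: E_def)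
  define \<theta> where "\<theta> = (b - (\<Sum>j\<in>F. w j * v j)) / sum w E"
  define \<rho> where "\<rho> = sum p E / sum w E"
  define u where "u i = p i - \<rho> * w i" for i
  have WE: "sum w E > 0" using sum_rest_pos[OF F(1) FL] by (simp add: E_def)
  have "\<theta> \<in> {1/3..2/3}" unfolding \<theta>_def E_def using v by (intro central F FL) fastforce+
  then have \<theta>: "1/3 \<le> \<theta>" "\<theta> \<le> 2/3" by auto
  have p_int: "p i \<in> \<int>" if "i < n" for i using p that by (auto simp: integer_vectors_def)
  have xQ: "x \<in> Q" using x Q binary_points_mono[of m "m + 264" n w b] hull_subset[of "binary_points n w b (m + 264)" convex] by auto
  have room: "F \<union> S \<subseteq> {..<n}" "card (F \<union> S) \<le> m + 264" "card (F \<union> S) \<le> L"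
    "{..<n} - (F \<union> S) = E - S"
    if "S \<subseteq> E" "card S \<le> 264" for S
  proof -
    show "F \<union> S \<subseteq> {..<n}" "{..<n} - (F \<union> S) = E - S" using that F by (auto simp: E_def)
    show "card (F \<union> S) \<le> m + 264" using card_Un_le[of F S] F(2) that(2) by linarith
    then show "card (F \<union> S) \<le> L" using m by linarith
  qed
  show ?thesis
  proof (cases "\<exists>S\<subseteq>E. card S \<le> 264 \<and> \<bar>sum u S\<bar> \<ge> 3")
    case True
    then obtain S where S: "S \<subseteq> E" "card S \<le> 264" and big: "\<bar>sum u S\<bar> \<ge> 3" by blast
    note R = room[OF S]
    have finS: "finite S" and FS: "F \<inter> S = {}" using S(1) finE finite_subset by (auto simp: E_def)
    have W': "sum w (E - S) > 0" using sum_rest_pos[OF R(1,3)] R(4) by simp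
    \<comment> \<open>\<open>S\<close> shifted by \<open>\<delta>\<close>, the rest of \<open>E\<close> compensating; \<open>D\<close> is the slope of \<open>p\<close> along this family\<close>
    define y where "y \<delta> = balanced_point n w b (F \<union> S) (\<lambda>i. if i \<in> F then v i else \<theta> + \<delta>)" for \<delta>
    define D where "D = sum p S - sum w S / sum w (E - S) * sum p (E - S)"
    have split_sum: "(\<Sum>j\<in>F \<union> S. q j * (if j \<in> F then v j else \<theta> + \<delta>)) = (\<Sum>j\<in>F. q j * v j) + (\<theta> + \<delta>) * sum q S" for q \<delta>
    proof -
      have "(\<Sum>j\<in>F \<union> S. q j * (if j \<in> F then v j else \<theta> + \<delta>)) =
          (\<Sum>j\<in>F. q j * (if j \<in> F then v j else \<theta> + \<delta>)) + (\<Sum>j\<in>S. q j * (if j \<in> F then v j else \<theta> + \<delta>))"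
        by (rule sum.union_disjoint[OF finF finS FS])
      also have "(\<Sum>j\<in>S. q j * (if j \<in> F then v j else \<theta> + \<delta>)) = (\<theta> + \<delta>) * sum q S"
        unfolding sum_distrib_left using FS by (intro sum.cong) auto
      finally show ?thesis by simp
    qed
    have py: "inner_prod n p (y \<delta>) = inner_prod n p (y 0) + \<delta> * D" for \<delta>
      unfolding y_def inner_prod_balanced_point_general[OF R(1)] R(4) split_sum D_def
      using W' by (simp add: field_simps)
    have yx: "y 0 = x"
    proof -
      have "y 0 = balanced_point n w b (F \<union> S) x"
        unfolding y_def xF using S(1)
        by (intro balanced_point_cong) (auto simp: balanced_point_def E_def \<theta>_def)
      also have "\<dots> = x"
        unfolding xF using balanced_point_extend[of F "F \<union> S" n w b v] R(1) W' WE R(4) E_def by auto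
      finally show ?thesis .
    qed
    have mid: "(1/2) *\<^sub>R y (1/3) + (1/2) *\<^sub>R y (-1/3) = x"
    proof -
      have avg: "(\<lambda>i. (1 - 1/2) * (if i \<in> F then v i else \<theta> + 1/3) + 1/2 * (if i \<in> F then v i else \<theta> + -1/3))
          = (\<lambda>i. if i \<in> F then v i else \<theta> + 0)"
        by (auto simp: fun_eq_iff field_simps)
      have "(1 - 1/2) *\<^sub>R y (1/3) + (1/2) *\<^sub>R y (-1/3) = y 0"
        unfolding y_def balanced_point_affine[symmetric] avg ..
      then show ?thesis using yx by simp
    qed
    have yQ: "y \<delta> \<in> Q" if "\<bar>\<delta>\<bar> \<le> 1/3" for \<delta>
    proof -
      have "0 \<le> (if i \<in> F then v i else \<theta> + \<delta>) \<and> (if i \<in> F then v i else \<theta> + \<delta>) \<le> 1" for i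
        using v[of i] \<theta> that by (auto simp: abs_le_iff)
      then have "y \<delta> \<in> convex hull binary_points n w b (m + 264)"
        unfolding y_def by (rule balanced_point_in_hull_binary_points[OF R(1,2)])
      then show ?thesis using Q by (rule subsetD[rotated])
    qed
    have "sum p E = \<rho> * sum w E" using WE by (simp add: \<rho>_def)
    moreover have pS: "sum p S = sum u S + \<rho> * sum w S"
      by (simp add: u_def sum_subtractf sum_distrib_left)
    moreover have "sum p (E - S) = sum p E - sum p S" "sum w (E - S) = sum w E - sum w S"
      using sum_diff[OF finE S(1)] by blast+
    moreover have "\<rho> * (sum w E - sum w S) = \<rho> * sum w E - \<rho> * sum w S"
      by (rule right_diff_distrib)
    ultimately have pE: "sum p (E - S) = \<rho> * sum w (E - S) - sum u S" by simp
    then have D: "D = sum u S * (1 + sum w S / sum w (E - S))"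
      unfolding D_def pE pS using W' by (simp add: field_simps)
    have "sum w S \<ge> 0" using S(1) w_pos by (intro sum_nonneg) (auto simp: E_def intro: less_imp_le)
    then have "\<bar>sum u S\<bar> * 1 \<le> \<bar>D\<bar>"
      unfolding D abs_mult using W' by (intro mult_left_mono) (auto simp: divide_nonneg_pos)
    with big have D3: "\<bar>D\<bar> \<ge> 3" by linarith
    show ?thesis
    proof (cases "inner_prod n p x \<le> of_int p0 \<or> inner_prod n p x \<ge> of_int p0 + 1")
      case True
      then show ?thesis using xQ by (intro hull_inc) auto
    next
      case False
      have "inner_prod n p (y (1/3)) = inner_prod n p x + D / 3"
        "inner_prod n p (y (-1/3)) = inner_prod n p x - D / 3"
        using py[of "1/3"] py[of "-1/3"] yx by auto
      then have "y (1/3) \<in> ?U" "y (-1/3) \<in> ?U"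
        using D3 False yQ[of "1/3"] yQ[of "-1/3"] by (auto simp: abs_if split: if_splits)
      then have "(1/2) *\<^sub>R y (1/3) + (1/2) *\<^sub>R y (-1/3) \<in> convex hull ?U"
        by (intro convexD[OF convex_convex_hull] hull_inc) auto
      then show ?thesis using mid by simp
    qed
  next
    case False
    \<comment> \<open>\<open>132 \<cdot> 1/44 = 3\<close>, so 132 large entries of \<open>u\<close> of the same sign would form a forbidden set\<close>
    have few: "card {i \<in> E. s * u i \<ge> 1/44} \<le> 131" if s: "s = 1 \<or> s = -1" for s
    proof (rule ccontr)
      assume "\<not> card {i \<in> E. s * u i \<ge> 1/44} \<le> 131"
      then have "132 \<le> card {i \<in> E. s * u i \<ge> 1/44}" by linarith
      then obtain S where S: "S \<subseteq> {i \<in> E. s * u i \<ge> 1/44}" "card S = 132"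
        by (rule obtain_subset_with_card_n)
      have "of_nat (card S) * (1/44) \<le> (\<Sum>i\<in>S. s * u i)" using S(1) by (intro sum_bounded_below) auto
      then have "3 \<le> s * sum u S" using S(2) by (simp add: sum_distrib_left)
      then have "\<bar>sum u S\<bar> \<ge> 3" using s by auto
      moreover have "S \<subseteq> E" "card S \<le> 264" using S by auto
      ultimately show False using False by blast
    qed
    define S where "S = {i \<in> E. 1 * u i \<ge> 1/44} \<union> {i \<in> E. -1 * u i \<ge> 1/44}"
    have SE: "S \<subseteq> E" by (auto simp: S_def)
    have S264: "card S \<le> 264"
      using few[of 1] few[of "-1"] card_Un_le[of "{i \<in> E. 1 * u i \<ge> 1/44}" "{i \<in> E. -1 * u i \<ge> 1/44}"]
      unfolding S_def by linarith
    note R = room[OF SE S264]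
    have "\<exists>c\<in>\<int>. \<forall>i\<in>E - S. p i = c * w i"
    proof (rule rigid[where \<rho>=\<rho>])
      have "{..<n} - (E - S) = F \<union> S" using SE F by (auto simp: E_def)
      then show "card ({..<n} - (E - S)) \<le> L" using R(3) by simp
      show "\<bar>p i - \<rho> * w i\<bar> < 1/44" if "i \<in> E - S" for i
        using that unfolding S_def u_def by (auto simp: abs_if)
    qed (auto simp: E_def p_int)
    then obtain c where c: "c \<in> \<int>" "\<And>i. i \<in> E - S \<Longrightarrow> p i = c * w i" by blast
    have W': "sum w (E - S) > 0" using sum_rest_pos[OF R(1,3)] R(4) by simp
    have "balanced_point n w b (F \<union> S) z \<in> ?U" if z: "\<forall>i\<in>F \<union> S. z i \<in> {0, 1}" for z
    proof -
      let ?y = "balanced_point n w b (F \<union> S) z"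
      have "?y \<in> binary_points n w b (m + 264)" using z R(1,2) unfolding binary_points_def by blast
      then have yQ: "?y \<in> Q" using Q hull_subset[of "binary_points n w b (m + 264)" convex] by blast
      have "sum p (E - S) = c * sum w (E - S)" using c(2) by (simp add: sum_distrib_left)
      then have "inner_prod n p ?y = (\<Sum>j\<in>F \<union> S. p j * z j) + c * (b - (\<Sum>j\<in>F \<union> S. w j * z j))"
        unfolding inner_prod_balanced_point_general[OF R(1)] R(4) using W' by simp
      moreover have "(\<Sum>j\<in>F \<union> S. q j * z j) \<in> \<int>" if "\<And>j. j < n \<Longrightarrow> q j \<in> \<int>" for q
      proof (rule Ints_sum)
        fix j assume j: "j \<in> F \<union> S"
        then have "z j = 0 \<or> z j = 1" using z by auto
        moreover have "q j \<in> \<int>" using j R(1) that by blast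
        ultimately show "q j * z j \<in> \<int>" by auto
      qed
      ultimately have "inner_prod n p ?y \<in> \<int>"
        using p_int w_int c(1) b_int by (auto intro!: Ints_add Ints_mult Ints_diff)
      then obtain k where "inner_prod n p ?y = of_int k" by (elim Ints_cases)
      then show ?thesis using yQ by (cases "k \<le> p0") auto
    qed
    then have "convex hull {balanced_point n w b (F \<union> S) z |z. \<forall>i\<in>F \<union> S. z i \<in> {0, 1}} \<subseteq> convex hull ?U"
      by (intro hull_mono) blast
    moreover have "x \<in> convex hull {balanced_point n w b (F \<union> S) z |z. \<forall>i\<in>F \<union> S. z i \<in> {0, 1}}"
    proof -
      have "x = balanced_point n w b (F \<union> S) x"
        unfolding xF using balanced_point_extend[of F "F \<union> S" n w b v] R(1) W' WE R(4) E_def by auto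
      moreover have "x \<in> knapsack n w b" using binary_points_subset_knapsack[of m] m x by auto
      moreover have "finite (F \<union> S)" using R(1) finite_subset by blast
      ultimately show ?thesis
        using balanced_point_in_hull_of_binary[of "F \<union> S" x n w b] knapsackD(2,3) by metis
    qed
    ultimately show ?thesis by blast
  qed
qed

lemma binary_points_subset_split_closure:
  assumes "convex hull binary_points n w b (m + 264) \<subseteq> Q" "m + 264 \<le> L"
  shows "convex hull binary_points n w b m \<subseteq> split_closure n Q"
proof (rule hull_minimal)
  show "binary_points n w b m \<subseteq> split_closure n Q"
    unfolding split_closure_def using binary_point_survives_split[OF assms] by blast
  show "convex (split_closure n Q)"
    unfolding split_closure_def by (intro convex_INT convex_convex_hull)
qed

lemma binary_points_subset_split_closure_iterate:
  assumes "m + 264 * k \<le> L"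
  shows "convex hull binary_points n w b m \<subseteq> (split_closure n ^^ k) (knapsack n w b)"
  using assms
proof (induction k arbitrary: m)
  case 0
  then show ?case
    by (simp add: hull_minimal binary_points_subset_knapsack convex_knapsack)
next
  case (Suc k)
  then have "convex hull binary_points n w b (m + 264) \<subseteq> (split_closure n ^^ k) (knapsack n w b)"
    by (intro Suc.IH) simp
  then show ?case using Suc.prems by (auto intro!: binary_points_subset_split_closure[THEN subsetD])
qed

text \<open>
  Without integer points the integer hull is empty, but the point with no prescribed coordinate survives
  all rounds that the budget \<open>L\<close> pays for.
\<close>

lemma split_rank_ge:
  assumes "knapsack n w b \<inter> integer_vectors n = {}"
  shows "enat (Suc (L div 264)) \<le> split_rank n (knapsack n w b)"
  unfolding split_rank_def
proof (rule Inf_greatest)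
  fix e assume "e \<in> {enat k |k. (split_closure n ^^ k) (knapsack n w b) = integer_hull n (knapsack n w b)}"
  then obtain k where k: "e = enat k" "(split_closure n ^^ k) (knapsack n w b) = {}"
    using assms by (auto simp: integer_hull_def)
  have "balanced_point n w b {} (\<lambda>_. 0) \<in> binary_points n w b 0"
    unfolding binary_points_def by (intro CollectI exI[of _ "{}"] exI conjI) (rule refl, auto)
  then have "convex hull binary_points n w b 0 \<noteq> {}" by auto
  then have "\<not> 264 * k \<le> L"
    using binary_points_subset_split_closure_iterate[of 0 k] k by auto
  then have "Suc (L div 264) \<le> k" by (metis Suc_leI div_less_iff_less_mult linorder_not_le mult.commute zero_less_numeral)
  then show "enat (Suc (L div 264)) \<le> e" using k by simp
qed

end

section \<open>Generic residues\<close>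

text \<open>
  The residues \<open>a\<close> for which \<open>k a / N\<close> is within \<open>1/22\<close> of an integer. They are represented in \<open>{1..N}\<close> and not
  in \<open>{0..<N}\<close> because they serve as weights, which have to be positive.
\<close>

definition close_residues :: "int \<Rightarrow> int \<Rightarrow> int set" where
  "close_residues N k = {a \<in> {1..N}. \<exists>m. 22 * \<bar>N * m - k * a\<bar> < N}"

lemma close_residues_mod: "close_residues N (k mod N) = close_residues N k"
proof -
  have shift: "N * m - k * a = N * (m - k div N * a) - (k mod N) * a" for m a
  proof -
    have "N * m - (N * q + r) * a = N * (m - q * a) - r * a" for q r by (simp add: algebra_simps)
    from this[of "k div N" "k mod N"] show ?thesis by simp
  qed
  have "(\<exists>m. 22 * \<bar>N * m - k * a\<bar> < N) \<longleftrightarrow> (\<exists>m. 22 * \<bar>N * m - (k mod N) * a\<bar> < N)" for a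
  proof
    assume "\<exists>m. 22 * \<bar>N * m - k * a\<bar> < N"
    then show "\<exists>m. 22 * \<bar>N * m - (k mod N) * a\<bar> < N" using shift by metis
  next
    assume "\<exists>m. 22 * \<bar>N * m - (k mod N) * a\<bar> < N"
    then obtain m where "22 * \<bar>N * m - (k mod N) * a\<bar> < N" by blast
    then have "22 * \<bar>N * (m + k div N * a) - k * a\<bar> < N" using shift[of "m + k div N * a" a] by simp
    then show "\<exists>m. 22 * \<bar>N * m - k * a\<bar> < N" by blast
  qed
  then show ?thesis by (simp add: close_residues_def)
qed

text \<open>
  The greatest common divisor of \<open>k\<close> and the modulus is a smaller power of 11, so it divides the eleventh part
  of the modulus. This is the place where the modulus has to be a prime power.
\<close>

lemma multiple_congruent_one_eleventh:
  assumes "\<not> (11::int) ^ Suc s dvd k"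
  shows "\<exists>t y. k * t = 11 ^ s + 11 ^ Suc s * y"
proof -
  have "prime (11::int)" by simp
  then obtain j where j: "j \<le> Suc s" "normalize (gcd k (11 ^ Suc s)) = (11::int) ^ j"
    using divides_primepow[of "11::int" "gcd k (11 ^ Suc s)" "Suc s"] by auto
  then have g: "gcd k (11 ^ Suc s) = (11::int) ^ j" by simp
  have "j \<noteq> Suc s" using g assms by (metis gcd_dvd1)
  then have "j \<le> s" using j by simp
  then have pow: "(11::int) ^ j * 11 ^ (s - j) = 11 ^ s" by (simp flip: power_add)
  obtain x z where "x * k + z * 11 ^ Suc s = gcd k (11 ^ Suc s)" using bezout_int by blast
  then have "(x * k + z * 11 ^ Suc s) * 11 ^ (s - j) = 11 ^ s" unfolding g using pow by simp
  then have "k * (x * 11 ^ (s - j)) = 11 ^ s + 11 ^ Suc s * (- (z * 11 ^ (s - j)))"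
    by (simp add: algebra_simps)
  then show ?thesis by blast
qed

text \<open>
  Take \<open>t\<close> such that \<open>k t / N\<close> is \<open>1/11\<close> modulo 1. Translation by \<open>t\<close> then shifts \<open>k a / N\<close> by \<open>1/11\<close>, and so
  the eleven translates of the close residues by \<open>0, t, \<dots>, 10 t\<close> are disjoint: two points of the circle within
  \<open>1/22\<close> of 0 differ by less than \<open>1/11\<close>.
\<close>

lemma card_close_residues:
  assumes N: "N = (11::int) ^ s" "s > 0" and k: "\<not> N dvd k"
  shows "11 * card (close_residues N k) \<le> 11 ^ s"
proof -
  obtain s' where s': "s = Suc s'" using N(2) by (cases s) auto
  define M where "M = (11::int) ^ s'"
  have NM: "N = 11 * M" and M: "M > 0" by (simp_all add: N s' M_def)
  obtain t y where t: "k * t = M + N * y"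
    using multiple_congruent_one_eleventh k unfolding N s' M_def by blast
  let ?H = "close_residues N k"
  let ?f = "\<lambda>(j, a). (a + j * t) mod N"
  have "inj_on ?f ({0..<11} \<times> ?H)"
  proof (rule inj_onI, clarify)
    fix j a j' a' assume j: "j \<in> {0..<11}" "j' \<in> {0..<11}" and a: "a \<in> ?H" "a' \<in> ?H"
      and eq: "(a + j * t) mod N = (a' + j' * t) mod N"
    obtain z where "(a + j * t) - (a' + j' * t) = N * z"
      using eq by (metis mod_eq_dvd_iff dvdE)
    then have z: "a - a' = N * z - (j - j') * t" by (simp add: algebra_simps)
    obtain m m' where m: "22 * \<bar>N * m - k * a\<bar> < N" "22 * \<bar>N * m' - k * a'\<bar> < N"
      using a by (auto simp: close_residues_def)
    have diff: "\<bar>(N * m - k * a) - (N * m' - k * a')\<bar> < M"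
    proof -
      have "\<bar>A - B\<bar> < M" if "22 * \<bar>A\<bar> < N" "22 * \<bar>B\<bar> < N" for A B using that NM by linarith
      then show ?thesis using m by blast
    qed
    define e where "e = m - m' - k * z + (j - j') * y"
    have "(N * m - k * a) - (N * m' - k * a') = N * (m - m') - k * (a - a')"
      by (simp add: algebra_simps)
    also have "\<dots> = N * (m - m') - k * (N * z) + (j - j') * (k * t)"
      unfolding z by (simp add: algebra_simps)
    also have "\<dots> = M * (11 * e + (j - j'))"
      unfolding t e_def NM by (simp add: algebra_simps)
    finally have "\<bar>M * (11 * e + (j - j'))\<bar> < M * 1" using diff by simp
    then have "11 * e + (j - j') = 0" using M by (simp add: abs_mult)
    then have jj: "j = j'" using j unfolding atLeastLessThan_iff by presburger
    then have "a - a' = N * z" using z by simp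
    moreover have "\<bar>a - a'\<bar> < N" using a by (auto simp: close_residues_def)
    ultimately have "a = a'" using NM M by (auto simp: abs_mult)
    then show "j = j' \<and> a = a'" using jj by simp
  qed
  moreover have "?f ` ({0..<11} \<times> ?H) \<subseteq> {0..<N}" using NM M by auto
  ultimately have "card ({0..<11::int} \<times> ?H) \<le> card {0..<N}"
    by (intro card_inj_on_le[where f = ?f]) auto
  then show ?thesis by (simp add: card_cartesian_product N nat_power_eq)
qed

text \<open>
  A union bound. Each of the fewer than \<open>11\<^sup>s\<close> nonzero classes of \<open>k\<close> and each of the at most \<open>8\<^sup>s\<close> sets \<open>T\<close> of size
  \<open>2 s\<close> spoils at most the fraction \<open>11\<close> to the power \<open>- 2 s\<close> of all choices of \<open>a\<close>, and \<open>11 \<cdot> 8 < 121\<close>.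
\<close>

lemma generic_residues_exist:
  assumes s: "s > 0" and N: "N = (11::int) ^ s"
  shows "\<exists>a. (\<forall>i<3 * s. a i \<in> {1..N}) \<and>
    (\<forall>k T. T \<subseteq> {..<3 * s} \<longrightarrow> (\<forall>i\<in>T. a i \<in> close_residues N k) \<longrightarrow> 2 * s \<le> card T \<longrightarrow> N dvd k)"
proof -
  let ?A = "Pi\<^sub>E {..<3 * s} (\<lambda>_. {1..N})"
  let ?B = "\<lambda>(k, T). Pi\<^sub>E {..<3 * s} (\<lambda>i. if i \<in> T then close_residues N k else {1..N})"
  let ?I = "{1..<N} \<times> {T \<in> Pow {..<3 * s}. card T = 2 * s}"
  have Nnat: "nat N = 11 ^ s" by (simp add: N nat_power_eq)
  have cB: "121 ^ s * card (?B c) \<le> card ?A" if c: "c \<in> ?I" for c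
  proof -
    obtain k T where kT: "c = (k, T)" "k \<in> {1..<N}" "T \<subseteq> {..<3 * s}" "card T = 2 * s" using c by auto
    have nd: "\<not> N dvd k" using kT(2) zdvd_imp_le[of N k] by auto
    have "card (?B c) = (\<Prod>i<3 * s. if i \<in> T then card (close_residues N k) else 11 ^ s)"
      by (simp add: kT(1) card_PiE Nnat if_distrib[of card] cong: if_cong)
    also have "\<dots> = (\<Prod>i\<in>{..<3 * s} - T. if i \<in> T then card (close_residues N k) else 11 ^ s) *
        (\<Prod>i\<in>T. if i \<in> T then card (close_residues N k) else 11 ^ s)"
      by (rule prod.subset_diff[OF kT(3)]) simp
    also have "\<dots> = (11 ^ s) ^ s * card (close_residues N k) ^ (2 * s)"
      using kT(3,4) by (simp add: card_Diff_subset finite_subset[OF kT(3)])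
    finally have "121 ^ s * card (?B c) = (11 ^ s) ^ s * (11 * card (close_residues N k)) ^ (2 * s)"
      by (simp add: power_mult power_mult_distrib)
    also have "\<dots> \<le> (11 ^ s) ^ s * (11 ^ s) ^ (2 * s)"
      using card_close_residues[OF N s nd] by (intro mult_left_mono power_mono) auto
    also have "\<dots> = card ?A" by (simp add: card_PiE Nnat flip: power_add)
    finally show ?thesis .
  qed
  have cI: "card ?I \<le> (11 ^ s - 1) * 8 ^ s"
  proof -
    have "card {T \<in> Pow {..<3 * s}. card T = 2 * s} \<le> card (Pow {..<3 * s})" by (intro card_mono) auto
    also have "\<dots> = 8 ^ s" by (simp add: card_Pow power_mult)
    finally have "card {T \<in> Pow {..<3 * s}. card T = 2 * s} \<le> 8 ^ s" .
    moreover have "card {1..<N} = 11 ^ s - 1" unfolding Nnat[symmetric] by simp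
    ultimately show ?thesis unfolding card_cartesian_product by (metis mult_le_mono order_refl)
  qed
  have "finite (close_residues N k)" for k
    by (rule finite_subset[of _ "{1..N}"]) (auto simp: close_residues_def)
  then have fin: "finite ?I" "finite (?B c)" for c by (auto intro!: finite_PiE split: prod.split)
  have cA: "card ?A > 0" by (simp add: card_PiE Nnat)
  have "121 ^ s * card (\<Union>c\<in>?I. ?B c) \<le> 121 ^ s * (\<Sum>c\<in>?I. card (?B c))"
    by (intro mult_left_mono card_UN_le fin) simp
  also have "\<dots> \<le> card ?I * card ?A"
    unfolding sum_distrib_left using sum_bounded_above[of ?I "\<lambda>c. 121 ^ s * card (?B c)" "card ?A"] cB by simp
  also have "\<dots> \<le> ((11 ^ s - 1) * 8 ^ s) * card ?A" using cI by (rule mult_right_mono) simp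
  also have "\<dots> < (11 ^ s * 11 ^ s) * card ?A"
  proof -
    have "(11 ^ s - 1) * 8 ^ s \<le> (11 ^ s - 1) * (11 ^ s :: nat)" by (intro mult_left_mono power_mono) auto
    also have "\<dots> < 11 ^ s * 11 ^ s" by (intro mult_strict_right_mono) auto
    finally show ?thesis using cA by (rule mult_strict_right_mono)
  qed
  also have "\<dots> = 121 ^ s * card ?A" by (simp flip: power_mult_distrib)
  finally have "card (\<Union>c\<in>?I. ?B c) < card ?A" by simp
  then have "\<not> ?A \<subseteq> (\<Union>c\<in>?I. ?B c)" using fin by (metis (no_types, lifting) card_mono finite_UN_I linorder_not_le)
  then obtain a where aA: "a \<in> ?A" and aU: "a \<notin> (\<Union>c\<in>?I. ?B c)" by (meson subsetI)
  have aB: "a \<notin> ?B c" if "c \<in> ?I" for c using aU that by (meson UN_I)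
  have "N dvd k" if T: "T \<subseteq> {..<3 * s}" "\<forall>i\<in>T. a i \<in> close_residues N k" "2 * s \<le> card T" for k T
  proof (rule ccontr)
    assume "\<not> N dvd k"
    then have "k mod N \<noteq> 0" by (simp add: dvd_eq_mod_eq_0)
    moreover have "N > 0" by (simp add: N)
    ultimately have k: "k mod N \<in> {1..<N}"
      using pos_mod_bound[of N k] pos_mod_sign[of N k] unfolding atLeastLessThan_iff by linarith
    obtain T' where T': "T' \<subseteq> T" "card T' = 2 * s" using obtain_subset_with_card_n[OF T(3)] by blast
    have "(k mod N, T') \<in> ?I" using k T' T(1) by auto
    then have out: "a \<notin> ?B (k mod N, T')" by (rule aB)
    have "a \<in> ?B (k mod N, T')"
      using aA T' T(2) by (auto simp: PiE_iff close_residues_mod)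
    with out show False by (rule notE)
  qed
  moreover have "\<forall>i<3 * s. a i \<in> {1..N}" using aA by (auto simp: PiE_iff)
  ultimately show ?thesis by blast
qed

text \<open>
  There are at most \<open>8\<^sup>s\<close> subset sums, but \<open>11\<^sup>s\<close> residues.
\<close>

lemma missed_residue_exists:
  fixes a :: "nat \<Rightarrow> int"
  assumes s: "s > 0" and N: "N = (11::int) ^ s"
  shows "\<exists>r\<in>{0..<N}. \<forall>T\<subseteq>{..<3 * s}. (\<Sum>i\<in>T. a i) mod N \<noteq> r"
proof (rule ccontr)
  assume *: "\<not> ?thesis"
  let ?R = "(\<lambda>T. (\<Sum>i\<in>T. a i) mod N) ` Pow {..<3 * s}"
  have "{0..<N} \<subseteq> ?R"
  proof
    fix r assume "r \<in> {0..<N}"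
    then obtain T where "T \<subseteq> {..<3 * s}" "(\<Sum>i\<in>T. a i) mod N = r" using * by blast
    then show "r \<in> ?R" by blast
  qed
  then have "card {0..<N} \<le> card ?R" by (intro card_mono) auto
  also have "\<dots> \<le> card (Pow {..<3 * s})" by (rule card_image_le) simp
  also have "\<dots> = 8 ^ s" by (simp add: card_Pow power_mult)
  finally have "11 ^ s \<le> (8::nat) ^ s" by (simp add: N nat_power_eq)
  moreover have "(8::nat) ^ s < 11 ^ s" using s by (intro power_strict_mono) auto
  ultimately show False by simp
qed

section \<open>A knapsack slice of linear split rank\<close>

text \<open>
  The first \<open>3 s\<close> weights are generic residues and all others are the modulus \<open>N\<close>. A weight \<open>N\<close> does not matter
  modulo \<open>N\<close>, so a right-hand side in a residue class missed by the subset sums excludes 0/1 solutions; being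
  free to add multiples of \<open>N\<close>, it can be placed within \<open>N\<close> of half the total weight, which yields centrality.
  For rigidity, a coordinate of weight \<open>N\<close> shows that \<open>\<rho>\<close> is very close to \<open>k / N\<close> with an integer \<open>k\<close>. Then
  \<open>k a / N\<close> is close to an integer for most of the generic weights \<open>a\<close>, so \<open>N\<close> divides \<open>k\<close>, and \<open>\<rho>\<close> itself is close
  to the integer \<open>k / N\<close>.
\<close>

lemma hard_knapsack_exists:
  assumes s: "s > 0" and n: "7 * s + 6 \<le> n"
  shows "\<exists>w b. robust_knapsack n w b s \<and> knapsack n w b \<inter> integer_vectors n = {}"
proof -
  define N where "N = (11::int) ^ s"
  have N0: "N > 0" by (simp add: N_def)
  obtain a where a: "\<And>i. i < 3 * s \<Longrightarrow> a i \<in> {1..N}"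
    and generic: "\<And>k T. T \<subseteq> {..<3 * s} \<Longrightarrow> (\<forall>i\<in>T. a i \<in> close_residues N k) \<Longrightarrow> 2 * s \<le> card T \<Longrightarrow> N dvd k"
    using generic_residues_exist[OF s N_def] by auto
  obtain r where "r \<in> {0..<N}" and r_missed: "\<And>T. T \<subseteq> {..<3 * s} \<Longrightarrow> (\<Sum>i\<in>T. a i) mod N \<noteq> r"
    using missed_residue_exists[OF s N_def] by blast
  then have r: "0 \<le> r" "r < N" by simp_all
  define wi where "wi i = (if i < 3 * s then a i else N)" for i
  define w where "w i = real_of_int (wi i)" for i
  define q where "q = \<lfloor>((\<Sum>i<n. w i) / 2 - r) / N\<rfloor>"
  define b where "b = real_of_int (r + N * q)"
  have wi: "1 \<le> wi i" "wi i \<le> N" for i using a[of i] N0 by (auto simp: wi_def)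
  have w: "0 < w i" "w i \<le> N" for i using wi[of i] by (auto simp: w_def)
  have b_bounds: "(\<Sum>i<n. w i) / 2 - N \<le> b" "b \<le> (\<Sum>i<n. w i) / 2"
  proof -
    have "real_of_int q \<le> ((\<Sum>i<n. w i) / 2 - r) / N" "((\<Sum>i<n. w i) / 2 - r) / N < real_of_int q + 1"
      unfolding q_def by linarith+
    then have "q * N \<le> (\<Sum>i<n. w i) / 2 - r" "(\<Sum>i<n. w i) / 2 - r < (real_of_int q + 1) * N"
      using N0 by (simp_all add: field_simps)
    then show "(\<Sum>i<n. w i) / 2 - N \<le> b" "b \<le> (\<Sum>i<n. w i) / 2"
      by (simp_all add: b_def algebra_simps)
  qed
  have "robust_knapsack n w b s"
  proof
    show "w i \<in> \<int>" "w i > 0" for i using w by (auto simp: w_def)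
    show "b \<in> \<int>" by (simp add: b_def)
    show "s < n" using n s by simp
  next
    fix F and v :: "nat \<Rightarrow> real"
    assume F: "F \<subseteq> {..<n}" "card F \<le> s" and v: "\<And>i. i \<in> F \<Longrightarrow> 0 \<le> v i \<and> v i \<le> 1"
    let ?E = "{..<n} - F"
    have finF: "finite F" using F(1) finite_subset by blast
    have WF: "sum w F \<le> real s * N"
    proof -
      have "sum w F \<le> real (card F) * N" using w by (intro sum_bounded_above) auto
      also have "\<dots> \<le> real s * N" using F(2) N0 by (intro mult_right_mono) auto
      finally show ?thesis .
    qed
    have WE: "(3 * real s + 6) * N \<le> sum w ?E"
    proof -
      have "card {3 * s..<n} - card F \<le> card ({3 * s..<n} - F)" by (rule diff_card_le_card_Diff[OF finF])
      then have "3 * s + 6 \<le> card ({3 * s..<n} - F)" using F(2) n by simp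
      then have "(3 * real s + 6) * N \<le> real (card ({3 * s..<n} - F)) * N"
        using N0 by (intro mult_right_mono) auto
      also have "\<dots> = sum w ({3 * s..<n} - F)" by (simp add: w_def wi_def)
      also have "\<dots> \<le> sum w ?E" using w by (intro sum_mono2) (auto intro: less_imp_le)
      finally show ?thesis .
    qed
    have tot: "(\<Sum>i<n. w i) = sum w ?E + sum w F" by (rule sum.subset_diff[OF F(1)]) simp
    have "0 \<le> (\<Sum>j\<in>F. w j * v j)" using v w by (intro sum_nonneg mult_nonneg_nonneg) (auto intro: less_imp_le)
    moreover have "(\<Sum>j\<in>F. w j * v j) \<le> sum w F"
      using v w by (intro sum_mono mult_left_le) (auto intro: less_imp_le)
    moreover have "0 < sum w ?E" using WE N0 by (smt (verit) mult_pos_pos of_int_0_less_iff of_nat_0_le_iff)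
    moreover have "3 * sum w F + 6 * real_of_int N \<le> sum w ?E" using WF WE by (simp add: algebra_simps)
    moreover have "real_of_int N > 0" using N0 by simp
    ultimately have pos: "0 < sum w ?E"
      and "1/3 * sum w ?E \<le> b - (\<Sum>j\<in>F. w j * v j)" "b - (\<Sum>j\<in>F. w j * v j) \<le> 2/3 * sum w ?E"
      using b_bounds unfolding tot by (simp_all add: field_simps)
    then show "(b - (\<Sum>j\<in>F. w j * v j)) / sum w ?E \<in> {1/3..2/3}"
      by (simp add: pos_le_divide_eq pos_divide_le_eq)
  next
    fix p :: "nat \<Rightarrow> real" and E :: "nat set" and \<rho> :: real
    assume p: "\<And>i. i < n \<Longrightarrow> p i \<in> \<int>" and E: "E \<subseteq> {..<n}" "card ({..<n} - E) \<le> s"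
      and close: "\<And>i. i \<in> E \<Longrightarrow> \<bar>p i - \<rho> * w i\<bar> < 1/44"
    \<comment> \<open>both kinds of weights keep enough coordinates in \<open>E\<close>\<close>
    have meets: "card A - s \<le> card (A \<inter> E)" if "A \<subseteq> {..<n}" for A
    proof -
      have "card A - card ({..<n} - E) \<le> card (A - ({..<n} - E))" by (rule diff_card_le_card_Diff) simp
      moreover have "A - ({..<n} - E) = A \<inter> E" using that E(1) by auto
      ultimately show ?thesis using E(2) by simp
    qed
    have "card {3 * s..<n} - s \<le> card ({3 * s..<n} \<inter> E)" by (rule meets) auto
    then have "card ({3 * s..<n} \<inter> E) > 0" using n by simp
    then obtain j where j: "j \<in> E" "3 * s \<le> j" by (auto simp: card_gt_0_iff)
    define m where "m i = \<lfloor>p i\<rfloor>" for i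
    have pm: "p i = m i" if "i \<in> E" for i using p[of i] that E(1) by (auto simp: m_def)
    define k where "k = m j"
    have k: "\<bar>k - \<rho> * N\<bar> < 1/44" using close[OF j(1)] j pm by (simp add: k_def w_def wi_def)
    have near: "22 * \<bar>N * m i - k * a i\<bar> < N" if i: "i \<in> E" "i < 3 * s" for i
    proof -
      have wa: "w i = a i" using i by (simp add: w_def wi_def)
      have "N * p i - k * w i = N * (p i - \<rho> * w i) - w i * (k - \<rho> * N)" by (simp add: algebra_simps)
      then have "\<bar>N * p i - k * w i\<bar> \<le> \<bar>N * (p i - \<rho> * w i)\<bar> + \<bar>w i * (k - \<rho> * N)\<bar>" by linarith
      also have "\<dots> < N * (1/44) + N * (1/44)"
      proof (rule add_less_le_mono)
        show "\<bar>N * (p i - \<rho> * w i)\<bar> < N * (1/44)" using close[OF i(1)] N0 by (simp add: abs_mult)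
        show "\<bar>w i * (k - \<rho> * N)\<bar> \<le> N * (1/44)"
          unfolding abs_mult using w[of i] k N0 by (intro mult_mono) auto
      qed
      finally have "real_of_int (22 * \<bar>N * m i - k * a i\<bar>) < real_of_int N"
        using pm[OF i(1)] wa by simp
      then show ?thesis by (simp only: of_int_less_iff)
    qed
    have "N dvd k"
    proof (rule generic)
      show "{..<3 * s} \<inter> E \<subseteq> {..<3 * s}" by simp
      show "\<forall>i\<in>{..<3 * s} \<inter> E. a i \<in> close_residues N k"
        using a near by (auto simp: close_residues_def)
      show "2 * s \<le> card ({..<3 * s} \<inter> E)" using meets[of "{..<3 * s}"] n by auto
    qed
    then obtain c where c: "k = N * c" by (elim dvdE)
    have "p i = of_int c * w i" if i: "i \<in> E" for i
    proof (cases "i < 3 * s")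
      case True
      have "22 * (N * \<bar>m i - c * a i\<bar>) < N"
        using near[OF i True] N0 unfolding c by (simp add: abs_mult mult.assoc flip: right_diff_distrib)
      then have "N * (22 * \<bar>m i - c * a i\<bar>) < N * 1" by simp
      then have "22 * \<bar>m i - c * a i\<bar> < 1" using N0 by (simp only: mult_less_cancel_left_pos)
      moreover have "x = 0" if "22 * \<bar>x\<bar> < 1" for x :: int using that by arith
      ultimately have "m i - c * a i = 0" by blast
      then show ?thesis using pm[OF i] True by (simp add: w_def wi_def)
    next
      case False
      then have "\<bar>m i - \<rho> * N\<bar> < 1/44" using close[OF i] pm[OF i] by (simp add: w_def wi_def)
      then have "\<bar>real_of_int (m i - k)\<bar> < 1" unfolding of_int_diff using k by linarith
      then have "m i = k" by linarith
      then show ?thesis using pm[OF i] False c by (simp add: w_def wi_def)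
    qed
    then show "\<exists>c\<in>\<int>. \<forall>i\<in>E. p i = c * w i" by (intro bexI[of _ "of_int c"]) auto
  qed
  moreover have "knapsack n w b \<inter> integer_vectors n = {}"
  proof (rule ccontr)
    assume "knapsack n w b \<inter> integer_vectors n \<noteq> {}"
    then obtain x where x: "x \<in> knapsack n w b" "x \<in> integer_vectors n" by blast
    have x01: "x i = of_int (of_bool (x i = 1))" if "i < n" for i
    proof -
      have "x i \<in> \<int>" using x(2) that by (simp add: integer_vectors_def)
      then obtain z where z: "x i = of_int z" by (rule Ints_cases)
      have "0 \<le> x i" "x i \<le> 1" by (rule knapsackD[OF x(1)])+
      then have "z = 0 \<or> z = 1" unfolding z by auto
      then show ?thesis using z by auto
    qed
    have "b = (\<Sum>i<n. w i * x i)" using knapsackD(4)[OF x(1)] by (simp add: inner_prod_def)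
    also have "\<dots> = (\<Sum>i<n. real_of_int (wi i * of_bool (x i = 1)))"
    proof (rule sum.cong[OF refl])
      fix i assume "i \<in> {..<n}"
      then have "x i = of_int (of_bool (x i = 1))" using x01 by blast
      then show "w i * x i = real_of_int (wi i * of_bool (x i = 1))" by (metis of_int_mult w_def)
    qed
    finally have "real_of_int (r + N * q) = real_of_int (\<Sum>i<n. wi i * of_bool (x i = 1))"
      by (simp add: b_def)
    then have "r + N * q = (\<Sum>i<n. wi i * of_bool (x i = 1))" by (simp only: of_int_eq_iff)
    also have "\<dots> = (\<Sum>i<3 * s. wi i * of_bool (x i = 1)) + (\<Sum>i=3 * s..<n. wi i * of_bool (x i = 1))"
      using n by (subst sum.atLeastLessThan_concat[of 0 "3 * s" n, symmetric, unfolded atLeast0LessThan]) auto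
    also have "(\<Sum>i<3 * s. wi i * of_bool (x i = 1)) = (\<Sum>i\<in>{i. i < 3 * s \<and> x i = 1}. a i)"
      by (rule sum.mono_neutral_cong_right) (auto simp: wi_def)
    also have "(\<Sum>i=3 * s..<n. wi i * of_bool (x i = 1)) = N * (\<Sum>i=3 * s..<n. of_bool (x i = 1))"
      unfolding sum_distrib_left by (intro sum.cong) (auto simp: wi_def)
    finally have "(r + N * q) mod N = ((\<Sum>i\<in>{i. i < 3 * s \<and> x i = 1}. a i) + N * (\<Sum>i=3 * s..<n. of_bool (x i = 1))) mod N"
      by simp
    then have "r = (\<Sum>i\<in>{i. i < 3 * s \<and> x i = 1}. a i) mod N" using r(1,2) by simp
    then show False using r_missed[of "{i. i < 3 * s \<and> x i = 1}"] by auto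
  qed
  ultimately show ?thesis by blast
qed

theorem corollary2:
  fixes t :: nat
  assumes "t > 0"
  shows "\<exists>(n0::nat) (C::real) (\<alpha>::real). n0 > 0 \<and> C > 0 \<and> \<alpha> > 0 \<and>
    (\<forall>n>n0. \<exists>P. polytope P \<and> P \<subseteq> unit_cube n \<and>
       finite (facets P) \<and> real (card (facets P)) \<le> C * real n \<and>
       ereal (\<alpha> * real n) \<le> ereal_of_enat (split_rank n P))"
proof (rule exI[of _ 26], rule exI[of _ 2], rule exI[of _ "1/2376"], intro conjI allI impI)
  show "(26::nat) > 0" "(2::real) > 0" "(1/2376::real) > 0" by simp_all
  fix n :: nat assume n: "n > 26"
  \<comment> \<open>\<open>s\<close> is as large as the requirement \<open>7 s + 6 \<le> n\<close> allows up to a constant factor; a round of split cuts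
    costs 264 of the \<open>s\<close> coordinates, and \<open>2376 = 9 \<cdot> 264\<close>\<close>
  define s where "s = n div 9"
  have "s \<ge> 3" "9 * s \<le> n" "n < 9 * (s + 1)" using n by (auto simp: s_def)
  then obtain w b where robust: "robust_knapsack n w b s" and free: "knapsack n w b \<inter> integer_vectors n = {}"
    using hard_knapsack_exists[of s n] by auto
  let ?P = "knapsack n w b"
  have "polytope ?P" using robust_knapsack.w_pos[OF robust] n by (intro polytope_knapsack) auto
  moreover have "?P \<subseteq> unit_cube n" by (auto simp: knapsack_def)
  moreover have "finite (facets ?P)" by (rule card_facets_knapsack)
  moreover have "real (card (facets ?P)) \<le> 2 * real n"
    using card_facets_knapsack(2)[of n w b] by linarith
  moreover have "ereal (1/2376 * real n) \<le> ereal_of_enat (split_rank n ?P)"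
  proof -
    define r where "r = Suc (s div 264)"
    have "s + 1 \<le> 264 * r" using dividend_less_times_div[of 264 s] by (simp add: r_def)
    then have "9 * (s + 1) \<le> 9 * (264 * r)" by (rule mult_le_mono2)
    with \<open>n < 9 * (s + 1)\<close> have "n \<le> 9 * (264 * r)" by (rule less_imp_le[OF less_le_trans])
    then have "real n \<le> real (9 * (264 * r))" by (rule of_nat_mono)
    then have "real n \<le> 2376 * real r" by simp
    then have "ereal (1/2376 * real n) \<le> ereal_of_enat (enat r)" by simp
    also have "\<dots> \<le> ereal_of_enat (split_rank n ?P)"
      using robust_knapsack.split_rank_ge[OF robust free] unfolding r_def by (simp only: ereal_of_enat_le_iff)
    finally show ?thesis .
  qed
  ultimately show "\<exists>P. polytope P \<and> P \<subseteq> unit_cube n \<and> finite (facets P) \<and>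
      real (card (facets P)) \<le> 2 * real n \<and> ereal (1/2376 * real n) \<le> ereal_of_enat (split_rank n P)"
    by blast
qed

end
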